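(* Let $n \ge 3$ and let $\phi$ be the Frobenius metric of the unitary group $U(n)$. The isometries of $(U(n), \phi)$ are precisely the following maps: $$X \mapsto AXB, \qquad X \mapsto AX^{*}B, \qquad X \mapsto A\overline{X}B, \qquad X \mapsto AX^{T}B,$$ with $A, B \in U(n)$.
   Context: $A^T$, $\overline{A}$, $A^* = \overline{A}^T$ denote transpose, conjugate and conjugate transpose. The Frobenius metric $\phi$ of $U(n)$ is the bi-invariant Riemannian metric obtained by restricting to $U(n)$ the flat metric $\phi(A,B) = \mathrm{Re}(\mathrm{tr}(AB^* ))$ of $M_n(\mathbb{C})$; explicitly, $\phi_A(X,Y) = -\mathrm{tr}(A^*XA^*Y)$ for every $A \in U(n)$ and $X, Y \in T_A(U(n))$. An isometry is a diffeomorphism of the group onto itself preserving the metric. *)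

theory Defs
  imports "HOL-Analysis.Analysis"
begin

section \<open>Smooth maps, tangent vectors and isometries on subsets of a Euclidean space\<close>

text \<open>On an open subset of a Euclidean space, \<open>Ck_on k f S\<close> is the usual notion of a \<open>C\<^sup>k\<close> map:
  every iterated directional derivative of order at most \<open>k\<close> exists and is continuous.\<close>

primrec Ck_on ::
    "nat \<Rightarrow> ('a::euclidean_space \<Rightarrow> 'b::euclidean_space) \<Rightarrow> 'a set \<Rightarrow> bool" where
  "Ck_on 0 f S \<longleftrightarrow> continuous_on S f"
| "Ck_on (Suc k) f S \<longleftrightarrow>
     (\<forall>x\<in>S. f differentiable (at x)) \<and>
     (\<forall>v. Ck_on k (\<lambda>x. frechet_derivative f (at x) v) S)"

definition smooth_on_open ::
    "('a::euclidean_space \<Rightarrow> 'b::euclidean_space) \<Rightarrow> 'a set \<Rightarrow> bool" where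
  "smooth_on_open f S \<longleftrightarrow> open S \<and> (\<forall>k. Ck_on k f S)"

text \<open>A map on an embedded submanifold \<open>M\<close> is smooth iff it extends locally to smooth maps on open
  subsets of the ambient space.\<close>

definition smooth_map_on ::
    "'a::euclidean_space set \<Rightarrow> ('a \<Rightarrow> 'b::euclidean_space) \<Rightarrow> bool" where
  "smooth_map_on M f \<longleftrightarrow>
     (\<forall>p\<in>M. \<exists>V F. p \<in> V \<and> smooth_on_open F V \<and> (\<forall>x\<in>V \<inter> M. F x = f x))"

definition diffeomorphism_of :: "'a::euclidean_space set \<Rightarrow> ('a \<Rightarrow> 'a) \<Rightarrow> bool" where
  "diffeomorphism_of M f \<longleftrightarrow>
     bij_betw f M M \<and> smooth_map_on M f \<and> smooth_map_on M (inv_into M f)"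

text \<open>\<open>curve_velocity M p v \<gamma>\<close>: \<open>\<gamma>\<close> is a smooth curve in \<open>M\<close>, defined near \<open>0\<close>, with
  \<open>\<gamma> 0 = p\<close> and velocity \<open>v\<close> at \<open>0\<close>.\<close>

definition curve_velocity ::
    "'a::euclidean_space set \<Rightarrow> 'a \<Rightarrow> 'a \<Rightarrow> (real \<Rightarrow> 'a) \<Rightarrow> bool" where
  "curve_velocity M p v \<gamma> \<longleftrightarrow>
     (\<exists>\<epsilon>>0. smooth_on_open \<gamma> {-\<epsilon><..<\<epsilon>} \<and> \<gamma> ` {-\<epsilon><..<\<epsilon>} \<subseteq> M) \<and>
     \<gamma> 0 = p \<and> (\<gamma> has_vector_derivative v) (at 0)"

definition tangent_space :: "'a::euclidean_space set \<Rightarrow> 'a \<Rightarrow> 'a set" where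
  "tangent_space M p = {v. \<exists>\<gamma>. curve_velocity M p v \<gamma>}"

text \<open>The differential at \<open>p\<close> sends the velocity of a curve \<open>\<gamma>\<close> in \<open>M\<close> to the velocity of
  \<open>f \<circ> \<gamma>\<close>.  It is only meaningful for \<open>f\<close> smooth on \<open>M\<close> and \<open>v \<in> tangent_space M p\<close>;
  the lemma \<open>differential_eq\<close> below shows that it then does not depend on the curve.\<close>

definition differential ::
    "'a::euclidean_space set \<Rightarrow> ('a \<Rightarrow> 'b::euclidean_space) \<Rightarrow> 'a \<Rightarrow> 'a \<Rightarrow> 'b" where
  "differential M f p v =
     (THE w. \<exists>\<gamma>. curve_velocity M p v \<gamma> \<and> ((f \<circ> \<gamma>) has_vector_derivative w) (at 0))"

lemma differential_eq:
  assumes F: "smooth_on_open F V" "p \<in> V" "\<And>x. x \<in> V \<inter> M \<Longrightarrow> F x = f x"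
    and v: "v \<in> tangent_space M p"
  shows "differential M f p v = frechet_derivative F (at p) v"
proof -
  have "Ck_on (Suc 0) F V" using F(1) unfolding smooth_on_open_def by blast
  then have dF: "(F has_derivative frechet_derivative F (at p)) (at p)"
    using F(2) by (simp add: frechet_derivative_works)
  have oV: "open V" using F(1) by (simp add: smooth_on_open_def)
  have key: "((f \<circ> \<gamma>) has_vector_derivative frechet_derivative F (at p) v) (at 0)"
    if g: "curve_velocity M p v \<gamma>" for \<gamma>
  proof -
    obtain \<epsilon> where e: "\<epsilon> > 0" "\<gamma> ` {-\<epsilon><..<\<epsilon>} \<subseteq> M" and g0: "\<gamma> 0 = p"
      and gd: "(\<gamma> has_vector_derivative v) (at 0)"
      using g unfolding curve_velocity_def by blast
    have 1: "((F \<circ> \<gamma>) has_vector_derivative frechet_derivative F (at p) v) (at 0)"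
      using vector_derivative_diff_chain_within[OF gd] dF g0 has_derivative_at_withinI by blast
    have "isCont \<gamma> 0" using gd has_vector_derivative_continuous by blast
    then have "\<forall>\<^sub>F t in nhds 0. \<gamma> t \<in> V"
      using oV F(2) g0 by (simp add: continuous_at_open eventually_nhds)
    moreover have "\<forall>\<^sub>F t in nhds (0::real). t \<in> {-\<epsilon><..<\<epsilon>}"
      using e(1) by (intro eventually_nhds_in_open) auto
    ultimately have ev: "\<forall>\<^sub>F t in nhds 0. (F \<circ> \<gamma>) t = (f \<circ> \<gamma>) t"
      by eventually_elim (use e(2) F(3) in \<open>auto simp: image_subset_iff\<close>)
    then obtain S where "open S" "0 \<in> S" "\<And>t. t \<in> S \<Longrightarrow> (F \<circ> \<gamma>) t = (f \<circ> \<gamma>) t"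
      unfolding eventually_nhds by blast
    with 1 show ?thesis by (rule has_vector_derivative_transform_within_open)
  qed
  obtain \<gamma> where "curve_velocity M p v \<gamma>" using v by (auto simp: tangent_space_def)
  then show ?thesis
    unfolding differential_def
    by (intro the_equality) (use key vector_derivative_unique_at in blast)+
qed

text \<open>Here \<open>g p\<close> is the inner product on the tangent space at \<open>p\<close>.\<close>

definition riemannian_isometry ::
    "'a::euclidean_space set \<Rightarrow> ('a \<Rightarrow> 'a \<Rightarrow> 'a \<Rightarrow> real) \<Rightarrow> ('a \<Rightarrow> 'a) \<Rightarrow> bool" where
  "riemannian_isometry M g f \<longleftrightarrow>
     diffeomorphism_of M f \<and>
     (\<forall>p\<in>M. \<forall>u\<in>tangent_space M p. \<forall>v\<in>tangent_space M p.
        g (f p) (differential M f p u) (differential M f p v) = g p u v)"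

section \<open>The unitary group and the Frobenius metric\<close>

definition conj_mat :: "complex^'n^'m \<Rightarrow> complex^'n^'m" where
  "conj_mat A = (\<chi> i j. cnj (A $ i $ j))"

definition adjoint_mat :: "complex^'n^'m \<Rightarrow> complex^'m^'n" where
  "adjoint_mat A = transpose (conj_mat A)"

definition unitary_group :: "(complex^'n^'n) set" where
  "unitary_group = {A. A ** adjoint_mat A = mat 1 \<and> adjoint_mat A ** A = mat 1}"

text \<open>The flat metric of the space of matrices; its value does not depend on the base point.\<close>

definition frobenius_metric ::
    "complex^'n^'n \<Rightarrow> complex^'n^'n \<Rightarrow> complex^'n^'n \<Rightarrow> real" where
  "frobenius_metric P X Y = Re (trace (X ** adjoint_mat Y))"

lemma bilinear_matrix_mult: "bilinear ((**) :: complex^'n^'m \<Rightarrow> complex^'p^'n \<Rightarrow> complex^'p^'m)"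
  unfolding bilinear_def
  by (auto intro!: linearI simp: matrix_matrix_mult_def vec_eq_iff sum.distrib algebra_simps
      scaleR_sum_right)

lemma linear_adjoint_mat: "linear adjoint_mat"
  by (rule linearI) (auto simp: adjoint_mat_def conj_mat_def transpose_def vec_eq_iff)

lemma adjoint_mat_mult: "adjoint_mat (A ** B) = adjoint_mat B ** adjoint_mat A"
  by (simp add: adjoint_mat_def conj_mat_def transpose_def matrix_matrix_mult_def vec_eq_iff
      mult.commute)

lemma adjoint_adjoint_mat [simp]: "adjoint_mat (adjoint_mat A) = A"
  by (simp add: adjoint_mat_def conj_mat_def transpose_def vec_eq_iff)

lemma tangent_space_unitary_group:
  assumes "X \<in> tangent_space unitary_group A"
  shows "A \<in> unitary_group" "adjoint_mat A ** X = - (adjoint_mat X ** A)"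
proof -
  obtain \<gamma> \<epsilon> where e: "\<epsilon> > 0" "\<And>t. t \<in> {-\<epsilon><..<\<epsilon>} \<Longrightarrow> \<gamma> t \<in> unitary_group" and g0: "\<gamma> 0 = A"
    and gd: "(\<gamma> has_vector_derivative X) (at 0)"
    using assms unfolding tangent_space_def curve_velocity_def by blast
  show "A \<in> unitary_group" using e g0 by force
  have bb: "bounded_bilinear ((**) :: complex^'n^'n \<Rightarrow> complex^'n^'n \<Rightarrow> complex^'n^'n)"
    by (simp add: bilinear_conv_bounded_bilinear [symmetric] bilinear_matrix_mult)
  have bl: "bounded_linear (adjoint_mat :: complex^'n^'n \<Rightarrow> complex^'n^'n)"
    by (simp add: linear_conv_bounded_linear [symmetric] linear_adjoint_mat)
  have "((\<lambda>t. adjoint_mat (\<gamma> t) ** \<gamma> t) has_vector_derivative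
      adjoint_mat (\<gamma> 0) ** X + adjoint_mat X ** \<gamma> 0) (at 0)"
    by (rule bounded_bilinear.has_vector_derivative[OF bb
        bounded_linear.has_vector_derivative[OF bl gd] gd])
  moreover have "((\<lambda>t. adjoint_mat (\<gamma> t) ** \<gamma> t) has_vector_derivative 0) (at 0)"
    by (rule has_vector_derivative_transform_within_open[where S = "{-\<epsilon><..<\<epsilon>}",
          OF has_vector_derivative_const[of "mat 1"]])
       (use e in \<open>auto simp: unitary_group_def\<close>)
  ultimately have "adjoint_mat A ** X + adjoint_mat X ** A = 0"
    using g0 vector_derivative_unique_at by metis
  then show "adjoint_mat A ** X = - (adjoint_mat X ** A)"
    by (simp add: eq_neg_iff_add_eq_0)
qed

text \<open>On tangent vectors the restricted flat metric is given by the explicit trace formula.\<close>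

lemma frobenius_metric_unitary_group:
  assumes X: "X \<in> tangent_space unitary_group A" and Y: "Y \<in> tangent_space unitary_group A"
  shows "complex_of_real (frobenius_metric A X Y) =
    - trace (adjoint_mat A ** X ** adjoint_mat A ** Y)"
proof -
  let ?P = "adjoint_mat A ** X" and ?Q = "adjoint_mat A ** Y"
  have A: "A ** adjoint_mat A = mat 1"
    using tangent_space_unitary_group(1)[OF X] by (simp add: unitary_group_def)
  have P: "adjoint_mat ?P = - ?P" and Q: "adjoint_mat ?Q = - ?Q"
    using tangent_space_unitary_group(2)[OF X] tangent_space_unitary_group(2)[OF Y]
    by (metis adjoint_mat_mult adjoint_adjoint_mat minus_minus)+
  have tr_cnj: "trace (adjoint_mat M) = cnj (trace M)" for M :: "complex^'n^'n"
    by (simp add: trace_def adjoint_mat_def conj_mat_def transpose_def)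
  have neg: "M ** (- N) = - (M ** N)" "(- M) ** N = - (M ** N)" "trace (- M) = - trace M"
    for M N :: "complex^'n^'n"
    by (simp_all add: matrix_matrix_mult_def vec_eq_iff sum_negf trace_def)
  have "trace (X ** adjoint_mat Y) = trace (A ** (adjoint_mat A ** X) ** adjoint_mat Y)"
    by (simp add: matrix_mul_assoc A)
  also have "\<dots> = trace (?P ** (adjoint_mat Y ** A))"
    by (metis trace_mul_sym matrix_mul_assoc)
  also have "\<dots> = trace (?P ** adjoint_mat ?Q)" by (simp add: adjoint_mat_mult)
  finally have 1: "trace (X ** adjoint_mat Y) = - trace (?P ** ?Q)" by (simp add: Q neg)
  have "cnj (trace (?P ** ?Q)) = trace (?Q ** ?P)"
    by (simp add: tr_cnj [symmetric] adjoint_mat_mult[of ?P] P Q neg)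
  also have "\<dots> = trace (?P ** ?Q)" by (rule trace_mul_sym)
  finally have "trace (?P ** ?Q) \<in> \<real>" by (simp add: Reals_cnj_iff)
  then show ?thesis
    by (simp add: frobenius_metric_def 1 matrix_mul_assoc)
qed

end

(* In one direction, the four kinds of maps are restrictions of linear maps of the matrix space that
   preserve the flat inner product and the unitary group.

   Conversely, an isometry f preserves the Levi-Civita connection by the Koszul formula, so it
   maps every curve c with c' = c X and c(0) = 1 to a curve with velocity f(c) T(X), where T is a
   linear isometry of the skew-Hermitian matrices. For a rank one projection P, the curve exp(i t
   P) is closed with period 2 pi; hence so is its image, so that T(i P) has eigenvalues in i Z and
   norm 1, which forces T(i P) = i Q or - i Q with Q again a rank one projection. The sign does
   not depend on P: T preserves tr(P P') >= 0, and any two P, P' are non-orthogonal to a common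
   third projection. The linear form of Wigner's theorem gives T(X) = U X U* or U X^T U* up to
   this sign, and since every unitary matrix lies on a curve c with c(0) = 1, the map f is
   determined by f(1) and T. *)

theory Submission
  imports Defs
begin

section \<open>Unitary and skew-Hermitian matrices\<close>

text \<open>An isometry lives on the group alone, so derivatives are taken of a local smooth
  extension \<open>F\<close> to matrix space. The symmetry of the ambient second derivative of
  \<open>F\<close> plays the part of torsion-freeness in the Koszul argument. The outcome is used in
  this form: the velocity of an image curve, pulled back to the identity, is skew-Hermitian, while
  its derivative turns out Hermitian, so it is constant. No matrix exponential occurs. For a rank
  one projection P the matrix K = i P satisfies K^3 = -K, so its one-parameter group is given by
  Rodrigues' formula. Such matrices span the skew-Hermitian ones, hence identities verified along
  these explicit curves extend by linearity. Norm 1 is decisive in the periodicity argument: one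
  nonzero integral eigenvalue already uses up the whole norm, leaving no room for a second one. The
  four families are the two signs combined with the two cases of Wigner's theorem. On skew-Hermitian
  X one has -X = X* and -X^T = conj X, so the sign is realized by adjoint or conjugate. Unlike
  negation, these maps preserve the group, fix 1, and respect products up to order.\<close>

interpretation matmul: bounded_bilinear
  "(**) :: complex^'n^'n \<Rightarrow> complex^'n^'n \<Rightarrow> complex^'n^'n"
  by (simp add: bilinear_conv_bounded_bilinear [symmetric] bilinear_matrix_mult)

interpretation matvec: bounded_bilinear
  "(*v) :: complex^'n^'n \<Rightarrow> complex^'n \<Rightarrow> complex^'n"
  unfolding bilinear_conv_bounded_bilinear [symmetric] bilinear_def
  by (auto intro!: linearI simp: matrix_vector_mult_def vec_eq_iff sum.distrib algebra_simps
      scaleR_sum_right)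

lemma bounded_linear_adjoint_mat: "bounded_linear (adjoint_mat :: complex^'n^'n \<Rightarrow> complex^'n^'n)"
  by (simp add: linear_conv_bounded_linear [symmetric] linear_adjoint_mat)

lemmas adjoint_mat_simps =
  bounded_linear_adjoint_mat[THEN bounded_linear.linear, THEN linear_add]
  bounded_linear_adjoint_mat[THEN bounded_linear.linear, THEN linear_diff]
  bounded_linear_adjoint_mat[THEN bounded_linear.linear, THEN linear_neg]
  bounded_linear_adjoint_mat[THEN bounded_linear.linear, THEN linear_scale]
  bounded_linear_adjoint_mat[THEN bounded_linear.linear, THEN linear_0]

lemma adjoint_mat_nth [simp]: "adjoint_mat A $ i $ j = cnj (A $ j $ i)"
  by (simp add: adjoint_mat_def conj_mat_def transpose_def)

lemma adjoint_mat_one [simp]: "adjoint_mat (mat 1) = mat 1"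
  by (auto simp: vec_eq_iff mat_def)

lemma inner_matrix: "inner A B = (\<Sum>i\<in>UNIV. \<Sum>j\<in>UNIV. Re (A $ i $ j * cnj (B $ i $ j)))"
  for A B :: "complex^'n^'m"
  by (simp add: inner_vec_def inner_complex_def)

lemma frobenius_metric_eq_inner: "frobenius_metric P A B = inner A B"
  by (simp add: frobenius_metric_def inner_matrix trace_def matrix_matrix_mult_def)

lemma inner_adjoint_mat: "inner (adjoint_mat A) (adjoint_mat B) = inner A B"
  for A B :: "complex^'n^'n"
  unfolding inner_matrix by (subst sum.swap) (simp add: algebra_simps)

lemma inner_conj_mat: "inner (conj_mat A) (conj_mat B) = inner A B"
  for A B :: "complex^'n^'n"
  by (simp add: inner_matrix conj_mat_def)

lemma inner_matmul_left: "inner (A ** B) C = inner B (adjoint_mat A ** C)"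
  for A B C :: "complex^'n^'n"
proof -
  have "inner (A ** B) C = Re (trace (A ** (B ** adjoint_mat C)))"
    using frobenius_metric_eq_inner[of 0 "A ** B" C]
    by (simp add: frobenius_metric_def matrix_mul_assoc)
  also have "\<dots> = Re (trace (B ** adjoint_mat (adjoint_mat A ** C)))"
    by (subst trace_mul_sym) (simp add: adjoint_mat_mult matrix_mul_assoc)
  also have "\<dots> = inner B (adjoint_mat A ** C)"
    using frobenius_metric_eq_inner[of 0] by (simp add: frobenius_metric_def)
  finally show ?thesis .
qed

lemma inner_matmul_right: "inner (B ** A) C = inner B (C ** adjoint_mat A)"
  for A B C :: "complex^'n^'n"
proof -
  have "inner (B ** A) C = inner (adjoint_mat A ** adjoint_mat B) (adjoint_mat C)"
    by (simp add: inner_adjoint_mat flip: adjoint_mat_mult)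
  also have "\<dots> = inner (adjoint_mat B) (adjoint_mat (C ** adjoint_mat A))"
    by (simp add: inner_matmul_left adjoint_mat_mult)
  finally show ?thesis by (simp add: inner_adjoint_mat)
qed

lemma unitary_groupD:
  assumes "A \<in> unitary_group"
  shows "A ** adjoint_mat A = mat 1" "adjoint_mat A ** A = mat 1"
    "A ** (adjoint_mat A ** B) = B" "adjoint_mat A ** (A ** B) = B"
    "B ** A ** adjoint_mat A = B" "B ** adjoint_mat A ** A = B"
  using assms by (simp_all add: unitary_group_def matrix_mul_assoc)
    (simp_all add: matrix_mul_assoc [symmetric])

lemma unitary_group_one: "mat 1 \<in> unitary_group"
  by (simp add: unitary_group_def)

lemma unitary_group_mult:
  assumes "A \<in> unitary_group" "B \<in> unitary_group" shows "A ** B \<in> unitary_group"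
proof -
  have "A ** B ** (adjoint_mat B ** adjoint_mat A) = mat 1"
    using assms by (simp add: matrix_mul_assoc unitary_groupD)
  moreover have "adjoint_mat B ** adjoint_mat A ** (A ** B) = mat 1"
    using assms by (metis matrix_mul_assoc unitary_groupD(2,4))
  ultimately show ?thesis by (simp add: unitary_group_def adjoint_mat_mult)
qed

lemma unitary_group_adjoint: "A \<in> unitary_group \<Longrightarrow> adjoint_mat A \<in> unitary_group"
  by (simp add: unitary_group_def)

lemma conj_mat_mult: "conj_mat (A ** B) = conj_mat A ** conj_mat B"
  by (simp add: conj_mat_def matrix_matrix_mult_def vec_eq_iff)

lemma transpose_eq_conj_adjoint: "transpose A = conj_mat (adjoint_mat A)"
  by (simp add: conj_mat_def transpose_def vec_eq_iff)

lemma adjoint_conj_mat: "adjoint_mat (conj_mat A) = conj_mat (adjoint_mat A)"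
  by (simp add: conj_mat_def vec_eq_iff)

lemma conj_conj_mat [simp]: "conj_mat (conj_mat A) = A"
  by (simp add: conj_mat_def vec_eq_iff)

lemma conj_mat_one [simp]: "conj_mat (mat 1) = mat 1"
  by (simp add: conj_mat_def mat_def vec_eq_iff)

lemma linear_conj_mat: "linear (conj_mat :: complex^'n^'n \<Rightarrow> complex^'n^'n)"
  by (rule linearI) (auto simp: conj_mat_def vec_eq_iff)

lemma unitary_group_conj: "A \<in> unitary_group \<Longrightarrow> conj_mat A \<in> unitary_group"
  by (simp add: unitary_group_def adjoint_conj_mat conj_mat_mult [symmetric])

lemma inner_unitary_left: "A \<in> unitary_group \<Longrightarrow> inner (A ** X) (A ** Y) = inner X Y"
  for A X Y :: "complex^'n^'n"
  by (simp add: inner_matmul_left unitary_groupD)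

lemma inner_unitary_right: "A \<in> unitary_group \<Longrightarrow> inner (X ** A) (Y ** A) = inner X Y"
  for A X Y :: "complex^'n^'n"
  by (simp add: inner_matmul_right unitary_groupD)

text \<open>The Lie algebra of the unitary group. Tangent vectors at \<open>p\<close> are written
  \<open>p ** X\<close> with \<open>X\<close> in this set, that is, as values of left-invariant
  fields.\<close>

definition skew :: "(complex^'n^'n) set" where
  "skew = {X. adjoint_mat X = - X}"

lemma subspace_skew: "subspace skew"
  by (auto simp: subspace_def skew_def adjoint_mat_simps)

lemma skew_conj: "X \<in> skew \<Longrightarrow> U ** X ** adjoint_mat U \<in> skew"
  for U X :: "complex^'n^'n"
  by (simp add: skew_def adjoint_mat_mult matrix_mul_assoc matmul.minus_left matmul.minus_right)

lemma matrix_eqI: "(\<And>x. A *v x = B *v x) \<Longrightarrow> A = B" for A B :: "complex^'n^'m"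
  by (simp add: matrix_eq)

section \<open>Hermitian product of vectors and rank one skew-Hermitian matrices\<close>

definition hdot :: "complex^'n \<Rightarrow> complex^'n \<Rightarrow> complex" where
  "hdot x y = (\<Sum>i\<in>UNIV. cnj (x $ i) * y $ i)"

lemma Re_hdot: "Re (hdot x y) = inner x y"
  by (simp add: hdot_def inner_vec_def inner_complex_def)

lemma hdot_add: "hdot x (y + z) = hdot x y + hdot x z" "hdot (x + y) z = hdot x z + hdot y z"
  by (simp_all add: hdot_def algebra_simps sum.distrib)

lemma hdot_smult: "hdot x (c *s y) = c * hdot x y" "hdot (c *s x) y = cnj c * hdot x y"
  by (simp_all add: hdot_def sum_distrib_left algebra_simps)

lemma hdot_minus: "hdot x (- y) = - hdot x y" "hdot (- x) y = - hdot x y"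
  by (simp_all add: hdot_def sum_negf)

lemma cnj_hdot: "cnj (hdot x y) = hdot y x"
  by (simp add: hdot_def mult.commute)

lemma norm_smult_complex: "norm (c *s x) = cmod c * norm x" for x :: "complex^'n"
proof -
  have "(norm (c *s x))\<^sup>2 = (cmod c * norm x)\<^sup>2"
    by (simp add: norm_vec_def L2_set_def sum_nonneg norm_mult power_mult_distrib sum_distrib_left)
  then show ?thesis by (simp add: power2_eq_iff_nonneg)
qed

lemma hdot_self: "hdot x x = of_real ((norm x)\<^sup>2)"
  by (simp add: complex_eq_iff Re_hdot power2_norm_eq_inner)
     (simp add: hdot_def)

lemma hdot_matvec: "hdot (A *v x) y = hdot x (adjoint_mat A *v y)"
proof -
  have "hdot (A *v x) y = (\<Sum>i\<in>UNIV. \<Sum>j\<in>UNIV. cnj (A$i$j) * cnj (x$j) * y$i)"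
    by (simp add: hdot_def matrix_vector_mult_def sum_distrib_right)
  also have "\<dots> = (\<Sum>j\<in>UNIV. \<Sum>i\<in>UNIV. cnj (A$i$j) * cnj (x$j) * y$i)"
    by (rule sum.swap)
  also have "\<dots> = hdot x (adjoint_mat A *v y)"
    by (simp add: hdot_def matrix_vector_mult_def sum_distrib_left algebra_simps)
  finally show ?thesis .
qed

lemma hdot_unitary: "U \<in> unitary_group \<Longrightarrow> hdot (U *v x) (U *v y) = hdot x y"
  by (simp add: hdot_matvec matrix_vector_mul_assoc unitary_groupD)

lemma hdot_axis: "hdot (axis k 1) v = v $ k" 
  by (simp add: hdot_def axis_def if_distrib [of cnj] if_distrib[of "\<lambda>x. x * _"] sum.delta cong: if_cong)

definition skew_dyad :: "complex^'n \<Rightarrow> complex^'n^'n" where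
  "skew_dyad v = (\<chi> i j. \<i> * v $ i * cnj (v $ j))"

lemma skew_dyad_nth [simp]: "skew_dyad v $ i $ j = \<i> * v $ i * cnj (v $ j)"
  by (simp add: skew_dyad_def)

lemma skew_dyad_skew: "skew_dyad v \<in> skew"
  by (simp add: skew_def vec_eq_iff)

lemma skew_dyad_matvec: "skew_dyad v *v y = (\<i> * hdot v y) *s v"
  by (simp add: hdot_def matrix_vector_mult_def vec_eq_iff sum_distrib_left sum_distrib_right
      algebra_simps)

lemma skew_dyad_smult: "skew_dyad (c *s v) = ((cmod c)\<^sup>2) *\<^sub>R skew_dyad v"
proof -
  have "complex_of_real ((cmod c)\<^sup>2) = c * cnj c" by (rule complex_norm_square)
  then show ?thesis by (simp add: vec_eq_iff scaleR_conv_of_real[where 'a=complex] del: of_real_power)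
qed

lemma skew_dyad_conj: "U ** skew_dyad v ** adjoint_mat U = skew_dyad (U *v v)"
proof (rule matrix_eqI)
  fix x
  show "(U ** skew_dyad v ** adjoint_mat U) *v x = skew_dyad (U *v v) *v x"
    by (simp add: matrix_vector_mul_assoc [symmetric] skew_dyad_matvec hdot_matvec
        vector_scalar_commute)
qed

lemma inner_skew_dyad: "inner S (skew_dyad x) = Im (hdot x (S *v x))"
proof -
  have "inner S (skew_dyad x) = Re (\<Sum>i\<in>UNIV. \<Sum>j\<in>UNIV. S$i$j * cnj (\<i> * x$i * cnj (x$j)))"
    by (simp add: inner_matrix)
  also have "(\<Sum>i\<in>UNIV. \<Sum>j\<in>UNIV. S$i$j * cnj (\<i> * x$i * cnj (x$j))) = -\<i> * hdot x (S *v x)"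
    unfolding hdot_def matrix_vector_mult_def sum_distrib_left
    by (intro sum.cong refl) (simp add: sum_distrib_left ac_simps)
  finally show ?thesis by simp
qed

lemma inner_skew_dyad_skew_dyad: "inner (skew_dyad u) (skew_dyad v) = (cmod (hdot u v))\<^sup>2"
proof -
  have "hdot v (skew_dyad u *v v) = \<i> * of_real ((cmod (hdot u v))\<^sup>2)"
    using complex_norm_square[of "hdot u v"] 
    by (simp add: skew_dyad_matvec hdot_smult cnj_hdot)
  then show ?thesis by (simp add: inner_skew_dyad)
qed

lemma norm_skew_dyad: "norm (skew_dyad v) = (norm v)\<^sup>2"
  unfolding norm_eq_sqrt_inner[of "skew_dyad v"] inner_skew_dyad_skew_dyad hdot_self norm_of_real
  by (simp add: real_sqrt_unique)

text \<open>The projection is idempotent and i^3 = -i. This identity is what collapses the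
  exponential series to Rodrigues' formula.\<close>

lemma unit_skew_dyad_cube:
  assumes "norm v = 1"
  shows "skew_dyad v ** (skew_dyad v ** skew_dyad v) = - skew_dyad v"
proof (rule matrix_eqI)
  fix x
  have "hdot v v = 1" using assms by (simp add: hdot_self)
  then show "(skew_dyad v ** (skew_dyad v ** skew_dyad v)) *v x = (- skew_dyad v) *v x"
    by (simp add: matrix_vector_mul_assoc [symmetric] skew_dyad_matvec hdot_smult hdot_minus
        matvec.minus_left vec_eq_iff)
qed

text \<open>Subtracting the two pure terms leaves only the cross terms of the dyad of e_i + z e_j,
  and \<open>z i j\<close> is chosen so that they are the entries of \<open>X\<close> at (i, j) and
  (j, i). The sum over ordered pairs meets each entry twice, whence the factor 1/2; the diagonal
  pairs give twice the diagonal entry.\<close>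

lemma skew_polarization:
  fixes X :: "complex^'n^'n"
  assumes "X \<in> skew"
  defines "z \<equiv> \<lambda>i j. cnj (- \<i> * X $ i $ j)"
  shows "X = (1/2) *\<^sub>R (\<Sum>i\<in>UNIV. \<Sum>j\<in>UNIV. skew_dyad (axis i 1 + axis j (z i j))
      - skew_dyad (axis i 1) - skew_dyad (axis j (z i j)))"
proof -
  have X: "cnj (X $ l $ k) = - X $ k $ l" for k l
    using assms(1) adjoint_mat_nth[of X k l] by (simp add: skew_def)
  have *: "(skew_dyad (axis i 1 + axis j (z i j)) - skew_dyad (axis i 1) - skew_dyad (axis j (z i j)))
      $ k $ l = (if i = k then if j = l then X $ k $ l else 0 else 0)
        + (if i = l then if j = k then X $ k $ l else 0 else 0)" for i j k l
    using X[of k l] X[of l k] by (auto simp: axis_def z_def algebra_simps)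
  have **: "(\<Sum>i\<in>UNIV. \<Sum>j\<in>UNIV. if i = k then if j = l then a else 0 else 0) = (a::complex)"
    for k l :: 'n and a
  proof -
    have "(\<Sum>j\<in>UNIV. if i = k then if j = l then a else 0 else 0) = (if i = k then a else 0)"
      for i by simp
    then show ?thesis by simp
  qed
  have ***: "(\<Sum>i\<in>UNIV. \<Sum>j\<in>UNIV. M i j) $ k $ l = (\<Sum>i\<in>UNIV. \<Sum>j\<in>UNIV. M i j $ k $ l)"
    for M :: "'n \<Rightarrow> 'n \<Rightarrow> complex^'n^'n" and k l
    by simp
  have ****: "(\<Sum>i\<in>UNIV. \<Sum>j\<in>UNIV. (if i = k then if j = l then a else 0 else 0) +
      (if i = l then if j = k then a else 0 else 0)) = a + (a::complex)" for k l :: 'n and a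
    unfolding sum.distrib ** ..
  show ?thesis
    unfolding vec_eq_iff vector_scaleR_component *** * ****
    by (simp add: scaleR_conv_of_real[where 'a=complex])
qed

text \<open>Unit vectors are required because only their dyads generate the Rodrigues curves along
  which later identities are differentiated.\<close>

lemma skew_subset_span: "skew \<subseteq> span (skew_dyad ` {v. norm v = 1})"
proof
  fix X :: "complex^'n^'n"
  assume X: "X \<in> skew"
  have dyad: "skew_dyad v \<in> span (skew_dyad ` {v. norm v = 1})" for v :: "complex^'n"
  proof (cases "v = 0")
    case True
    then have "skew_dyad v = 0" by (simp add: vec_eq_iff)
    then show ?thesis by (simp add: span_zero)
  next
    case False
    let ?u = "complex_of_real (1 / norm v) *s v"
    have u: "norm ?u = 1"
      using False unfolding norm_smult_complex by (simp add: norm_divide)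
    have "v = complex_of_real (norm v) *s ?u" using False by (simp add: vec_eq_iff)
    then have "skew_dyad v = (norm v)\<^sup>2 *\<^sub>R skew_dyad ?u"
      by (metis skew_dyad_smult norm_of_real power2_abs)
    then show ?thesis using u by (simp add: span_base span_scale)
  qed
  show "X \<in> span (skew_dyad ` {v. norm v = 1})"
    by (subst skew_polarization[OF X]) (intro span_scale span_sum span_diff dyad)
qed

section \<open>Second derivatives of smooth maps\<close>

text \<open>Young's argument: the mean value theorem in direction \<open>w\<close>, applied to the
  increment of the function in direction \<open>u\<close>, reduces the second difference to values
  of \<open>D x w\<close>, whose differentiability at \<open>p\<close> then suffices.\<close>

lemma second_difference_bound:
  fixes \<phi> :: "'a::real_normed_vector \<Rightarrow> real"
  assumes V: "open V" "p \<in> V"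
    and d: "\<And>x. x \<in> V \<Longrightarrow> (\<phi> has_derivative D x) (at x)"
    and dd: "((\<lambda>x. D x w) has_derivative A) (at p)"
    and e: "e > 0"
  shows "\<exists>\<delta>>0. \<forall>s. 0 < s \<and> s < \<delta> \<longrightarrow>
    \<bar>\<phi> (p + s *\<^sub>R u + s *\<^sub>R w) - \<phi> (p + s *\<^sub>R u) - \<phi> (p + s *\<^sub>R w) + \<phi> p - s\<^sup>2 * A u\<bar> \<le> e * s\<^sup>2"
proof -
  \<comment> \<open>For coefficients between 0 and \<open>s\<close>, the vector
    \<open>a *\<^sub>R u + t *\<^sub>R w\<close> has norm at most \<open>C * s\<close>; the summand
    1 keeps \<open>C\<close> positive.\<close>
  define C where "C = norm u + norm w + 1"
  have C: "C > 0" by (simp add: C_def add_nonneg_pos)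
  interpret A: bounded_linear A using dd by (rule has_derivative_bounded_linear)
  obtain d1 where d1: "d1 > 0" "\<And>y. norm (y - p) < d1 \<Longrightarrow>
      norm (D y w - D p w - A (y - p)) \<le> e / (2 * C) * norm (y - p)"
    using dd e C unfolding has_derivative_at_alt
    by (metis divide_pos_pos mult_pos_pos zero_less_numeral)
  obtain d2 where d2: "d2 > 0" "ball p d2 \<subseteq> V" using V openE by blast
  define \<delta> where "\<delta> = min d1 d2 / C"
  have "\<delta> > 0" using d1(1) d2(1) C by (simp add: \<delta>_def)
  moreover have "\<bar>\<phi> (p + s *\<^sub>R u + s *\<^sub>R w) - \<phi> (p + s *\<^sub>R u) - \<phi> (p + s *\<^sub>R w) + \<phi> p - s\<^sup>2 * A u\<bar> \<le> e * s\<^sup>2"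
    if s: "0 < s" "s < \<delta>" for s
  proof -
    have small: "norm (a *\<^sub>R u + t *\<^sub>R w) \<le> C * s" if "0 \<le> a" "a \<le> s" "0 \<le> t" "t \<le> s" for a t
    proof -
      have "norm (a *\<^sub>R u + t *\<^sub>R w) \<le> a * norm u + t * norm w"
        using that by (metis norm_triangle_ineq norm_scaleR abs_of_nonneg)
      also have "\<dots> \<le> s * norm u + s * norm w"
        using that by (intro add_mono mult_right_mono) auto
      also have "\<dots> \<le> C * s" using s by (simp add: C_def algebra_simps)
      finally show ?thesis .
    qed
    have Cs: "C * s < min d1 d2" using s C by (simp add: \<delta>_def field_simps)
    have inV: "p + (a *\<^sub>R u + t *\<^sub>R w) \<in> V" if "0 \<le> a" "a \<le> s" "0 \<le> t" "t \<le> s" for a t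
    proof -
      have "dist p (p + z) = norm z" for z by (simp add: dist_norm)
      then have "dist p (p + (a *\<^sub>R u + t *\<^sub>R w)) < d2"
        using small[OF that] Cs by simp
      then show ?thesis using d2(2) by auto
    qed
    have est: "\<bar>D (p + (a *\<^sub>R u + t *\<^sub>R w)) w - D p w - A (a *\<^sub>R u + t *\<^sub>R w)\<bar> \<le> e / 2 * s"
      if "0 \<le> a" "a \<le> s" "0 \<le> t" "t \<le> s" for a t
    proof -
      have "\<bar>D (p + (a *\<^sub>R u + t *\<^sub>R w)) w - D p w - A (a *\<^sub>R u + t *\<^sub>R w)\<bar>
          \<le> e / (2 * C) * norm (a *\<^sub>R u + t *\<^sub>R w)"
        using d1(2)[of "p + (a *\<^sub>R u + t *\<^sub>R w)"] small[OF that] Cs by simp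
      also have "\<dots> \<le> e / (2 * C) * (C * s)"
        using small[OF that] e C by (intro mult_left_mono) auto
      also have "\<dots> = e / 2 * s" using C by simp
      finally show ?thesis .
    qed
    define g where "g t = \<phi> (p + (s *\<^sub>R u + t *\<^sub>R w)) - \<phi> (p + (0 *\<^sub>R u + t *\<^sub>R w))" for t
    define g' where "g' t = D (p + (s *\<^sub>R u + t *\<^sub>R w)) w - D (p + (0 *\<^sub>R u + t *\<^sub>R w)) w" for t
    have "(g has_real_derivative g' t) (at t)" if t: "0 \<le> t" "t \<le> s" for t
    proof -
      have *: "((\<lambda>t. \<phi> (p + (a *\<^sub>R u + t *\<^sub>R w))) has_real_derivative D (p + (a *\<^sub>R u + t *\<^sub>R w)) w) (at t)"
        if a: "0 \<le> a" "a \<le> s" for a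
      proof -
        have dx: "((\<lambda>t. p + (a *\<^sub>R u + t *\<^sub>R w)) has_vector_derivative w) (at t)"
          by (auto intro!: derivative_eq_intros)
        have "((\<phi> \<circ> (\<lambda>t. p + (a *\<^sub>R u + t *\<^sub>R w))) has_vector_derivative D (p + (a *\<^sub>R u + t *\<^sub>R w)) w) (at t)"
          by (rule vector_derivative_diff_chain_within[OF dx])
             (use d[OF inV[OF a t]] in \<open>auto intro: has_derivative_at_withinI\<close>)
        then show ?thesis by (simp add: o_def has_real_derivative_iff_has_vector_derivative)
      qed
      show ?thesis unfolding g_def[abs_def] g'_def
        by (intro DERIV_diff *) (use s in auto)
    qed
    then obtain \<xi> where \<xi>: "0 < \<xi>" "\<xi> < s" "g s - g 0 = (s - 0) * g' \<xi>"
      using MVT2[of 0 s g g'] s(1) by auto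
    have "\<bar>g' \<xi> - s * A u\<bar> \<le> e * s"
    proof -
      \<comment> \<open>The linear approximations at the two points share the term in
        \<open>w\<close>, which cancels. Each point contributes an error of at most
        \<open>e / 2 * s\<close>.\<close>
      have "A (s *\<^sub>R u + \<xi> *\<^sub>R w) - A (0 *\<^sub>R u + \<xi> *\<^sub>R w) = s * A u"
        by (simp add: A.add A.scaleR)
      then show ?thesis
        using est[of s \<xi>] est[of 0 \<xi>] \<xi> s unfolding g'_def abs_le_iff by linarith
    qed
    then have "s * \<bar>g' \<xi> - s * A u\<bar> \<le> s * (e * s)" using s(1) by simp
    also have "s * \<bar>g' \<xi> - s * A u\<bar> = \<bar>s * (g' \<xi> - s * A u)\<bar>"
      using s(1) by (simp add: abs_mult)
    also have "s * (g' \<xi> - s * A u) = g s - g 0 - s\<^sup>2 * A u"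
      using \<xi>(3) by (simp add: algebra_simps power2_eq_square)
    finally show ?thesis by (simp add: g_def add.assoc power2_eq_square algebra_simps)
  qed
  ultimately show ?thesis by blast
qed

text \<open>The second difference is symmetric in \<open>u\<close> and \<open>w\<close>, so it
  approximates both values after division by the square of \<open>s\<close>.\<close>

lemma second_derivative_symmetric_real:
  fixes \<phi> :: "'a::real_normed_vector \<Rightarrow> real"
  assumes V: "open V" "p \<in> V"
    and d: "\<And>x. x \<in> V \<Longrightarrow> (\<phi> has_derivative D x) (at x)"
    and A: "((\<lambda>x. D x w) has_derivative A) (at p)"
    and B: "((\<lambda>x. D x u) has_derivative B) (at p)"
  shows "A u = B w"
proof (rule ccontr)
  assume "A u \<noteq> B w"
  \<comment> \<open>The two approximation errors add up to at most \<open>2 * e\<close>, which is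
    strictly less than the assumed gap \<open>3 * e\<close>.\<close>
  define e where "e = \<bar>A u - B w\<bar> / 3"
  have e: "e > 0" using \<open>A u \<noteq> B w\<close> by (simp add: e_def)
  obtain d1 where d1: "d1 > 0" "\<And>s. 0 < s \<and> s < d1 \<Longrightarrow>
    \<bar>\<phi> (p + s *\<^sub>R u + s *\<^sub>R w) - \<phi> (p + s *\<^sub>R u) - \<phi> (p + s *\<^sub>R w) + \<phi> p - s\<^sup>2 * A u\<bar> \<le> e * s\<^sup>2"
    using second_difference_bound[OF V d A e, of u] by blast
  obtain d2 where d2: "d2 > 0" "\<And>s. 0 < s \<and> s < d2 \<Longrightarrow>
    \<bar>\<phi> (p + s *\<^sub>R w + s *\<^sub>R u) - \<phi> (p + s *\<^sub>R w) - \<phi> (p + s *\<^sub>R u) + \<phi> p - s\<^sup>2 * B w\<bar> \<le> e * s\<^sup>2"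
    using second_difference_bound[OF V d B e, of w] by blast
  define s where "s = min d1 d2 / 2"
  have s: "0 < s" "s < d1" "s < d2" using d1(1) d2(1) by (auto simp: s_def)
  define q where "q = \<phi> (p + s *\<^sub>R u + s *\<^sub>R w) - \<phi> (p + s *\<^sub>R u) - \<phi> (p + s *\<^sub>R w) + \<phi> p"
  have "p + s *\<^sub>R w + s *\<^sub>R u = p + s *\<^sub>R u + s *\<^sub>R w" by simp
  then have "\<bar>q - s\<^sup>2 * A u\<bar> \<le> e * s\<^sup>2" "\<bar>q - s\<^sup>2 * B w\<bar> \<le> e * s\<^sup>2"
    using d1(2)[of s] d2(2)[of s] s unfolding q_def by (simp_all add: algebra_simps)
  then have "\<bar>s\<^sup>2 * A u - s\<^sup>2 * B w\<bar> \<le> 2 * e * s\<^sup>2" by linarith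
  also have "s\<^sup>2 * A u - s\<^sup>2 * B w = s\<^sup>2 * (A u - B w)" by (simp add: algebra_simps)
  finally have "s\<^sup>2 * \<bar>A u - B w\<bar> \<le> s\<^sup>2 * (2 * e)" by (simp only: abs_mult abs_power2 mult.commute)
  then have "\<bar>A u - B w\<bar> \<le> 2 * e" using s(1) by simp
  with e show False by (simp add: e_def)
qed

text \<open>The inner derivative has the fixed direction \<open>w\<close> and is then differentiated
  in direction \<open>u\<close>; this matches the recursion in \<open>Ck_on\<close>, which also
  differentiates along fixed directions.\<close>

definition fderiv2 ::
    "('a::euclidean_space \<Rightarrow> 'b::euclidean_space) \<Rightarrow> 'a \<Rightarrow> 'a \<Rightarrow> 'a \<Rightarrow> 'b" where
  "fderiv2 F p u w = frechet_derivative (\<lambda>x. frechet_derivative F (at x) w) (at p) u"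

lemma smooth_has_derivative:
  assumes "smooth_on_open F V" "p \<in> V"
  shows "(F has_derivative frechet_derivative F (at p)) (at p)"
proof -
  have "Ck_on (Suc 0) F V" using assms(1) unfolding smooth_on_open_def by blast
  then show ?thesis using assms(2) by (simp add: frechet_derivative_works)
qed

lemma smooth_linear_frechet_derivative:
  assumes "smooth_on_open F V" "p \<in> V"
  shows "linear (frechet_derivative F (at p))"
  using smooth_has_derivative[OF assms] by (rule has_derivative_linear)

lemma smooth_has_derivative2:
  assumes "smooth_on_open F V" "p \<in> V"
  shows "((\<lambda>x. frechet_derivative F (at x) w) has_derivative (\<lambda>u. fderiv2 F p u w)) (at p)"
proof -
  have "Ck_on (Suc (Suc 0)) F V" using assms(1) unfolding smooth_on_open_def by blast
  then show ?thesis unfolding fderiv2_def using assms(2) by (simp add: frechet_derivative_works)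
qed

lemma fderiv2_symmetric:
  assumes F: "smooth_on_open F V" "p \<in> V"
  shows "fderiv2 F p u w = fderiv2 F p w u"
proof (rule euclidean_eqI)
  fix b :: 'b
  show "inner (fderiv2 F p u w) b = inner (fderiv2 F p w u) b"
  proof (rule second_derivative_symmetric_real[where V = V and p = p
        and A = "\<lambda>u. inner (fderiv2 F p u w) b" and B = "\<lambda>w. inner (fderiv2 F p w u) b"])
    show "open V" using F by (simp add: smooth_on_open_def)
    show "((\<lambda>x. inner (F x) b) has_derivative (\<lambda>v. inner (frechet_derivative F (at x) v) b)) (at x)"
      if "x \<in> V" for x
      by (intro has_derivative_inner_left smooth_has_derivative[OF F(1)] that)
  qed (use F in \<open>auto intro!: has_derivative_inner_left smooth_has_derivative2\<close>)
qed

lemma linear_fderiv2: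
  assumes "smooth_on_open F V" "p \<in> V"
  shows "linear (\<lambda>u. fderiv2 F p u w)" "linear (\<lambda>w. fderiv2 F p u w)"
proof -
  show "linear (\<lambda>u. fderiv2 F p u w)" for w
    using smooth_has_derivative2[OF assms] by (rule has_derivative_linear)
  then show "linear (\<lambda>w. fderiv2 F p u w)"
    by (simp add: fderiv2_symmetric[OF assms, of u])
qed

text \<open>A product rule with moving base point and moving direction. Expanding \<open>h\<close>
  in the basis reduces it to fixed directions, where \<open>fderiv2\<close> is available.\<close>

lemma has_vector_derivative_frechet_along_curve:
  assumes F: "smooth_on_open F V" "e t \<in> V"
    and e: "(e has_vector_derivative e') (at t)" and h: "(h has_vector_derivative h') (at t)"
  shows "((\<lambda>s. frechet_derivative F (at (e s)) (h s)) has_vector_derivative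
    fderiv2 F (e t) e' (h t) + frechet_derivative F (at (e t)) h') (at t)"
proof -
  interpret D: linear "frechet_derivative F (at (e t))"
    by (rule smooth_linear_frechet_derivative[OF F])
  interpret D2: linear "fderiv2 F (e t) e'" by (rule linear_fderiv2(2)[OF F])
  have "open V" using F by (simp add: smooth_on_open_def)
  moreover have "isCont e t" using e has_vector_derivative_continuous by blast
  ultimately have ev: "\<forall>\<^sub>F s in nhds t. e s \<in> V"
    using F(2) by (simp add: continuous_at_open eventually_nhds)
  have b: "((\<lambda>s. frechet_derivative F (at (e s)) b) has_vector_derivative fderiv2 F (e t) e' b) (at t)" for b
    using vector_derivative_diff_chain_within[OF e, of "\<lambda>x. frechet_derivative F (at x) b"]
      smooth_has_derivative2[OF F, of b] has_derivative_at_withinI by (force simp: o_def)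
  have hb: "((\<lambda>s. inner (h s) b) has_real_derivative inner h' b) (at t)" for b
    unfolding has_real_derivative_iff_has_vector_derivative
    using bounded_linear.has_vector_derivative[OF bounded_linear_inner_left h] .
  have "((\<lambda>s. \<Sum>b\<in>Basis. inner (h s) b *\<^sub>R frechet_derivative F (at (e s)) b) has_vector_derivative
    (\<Sum>b\<in>Basis. inner (h t) b *\<^sub>R fderiv2 F (e t) e' b + inner h' b *\<^sub>R frechet_derivative F (at (e t)) b)) (at t)"
    by (intro has_vector_derivative_sum has_vector_derivative_scaleR b hb)
  also have "(\<Sum>b\<in>Basis. inner (h t) b *\<^sub>R fderiv2 F (e t) e' b + inner h' b *\<^sub>R frechet_derivative F (at (e t)) b)
     = fderiv2 F (e t) e' (h t) + frechet_derivative F (at (e t)) h'"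
    using arg_cong[OF euclidean_representation[of "h t"], of "fderiv2 F (e t) e'"]
      arg_cong[OF euclidean_representation[of h'], of "frechet_derivative F (at (e t))"]
    by (simp add: sum.distrib D.sum D.scaleR D2.sum D2.scaleR)
  finally have main: "((\<lambda>s. \<Sum>b\<in>Basis. inner (h s) b *\<^sub>R frechet_derivative F (at (e s)) b)
      has_vector_derivative fderiv2 F (e t) e' (h t) + frechet_derivative F (at (e t)) h') (at t)" .
  have eq: "(\<Sum>b\<in>Basis. inner (h s) b *\<^sub>R frechet_derivative F (at (e s)) b) =
      frechet_derivative F (at (e s)) (h s)" if "e s \<in> V" for s
  proof -
    interpret Ds: linear "frechet_derivative F (at (e s))"
      by (rule smooth_linear_frechet_derivative[OF F(1) that])
    show ?thesis
      using arg_cong[OF euclidean_representation[of "h s"], of "frechet_derivative F (at (e s))"]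
      by (simp add: Ds.sum Ds.scaleR)
  qed
  obtain T where "open T" "t \<in> T" "\<And>s. s \<in> T \<Longrightarrow> e s \<in> V"
    using ev unfolding eventually_nhds by blast
  then show ?thesis
    by (intro has_vector_derivative_transform_within_open[OF main]) (auto simp: eq)
qed

section \<open>Smoothness of linear maps and of trigonometric curves\<close>

lemma Ck_on_const: "Ck_on k (\<lambda>x. c) S"
  by (induction k arbitrary: c) (auto simp: frechet_derivative_const)

lemma frechet_derivative_bounded_linear:
  "bounded_linear G \<Longrightarrow> frechet_derivative G (at x) = G"
  by (metis bounded_linear_imp_has_derivative frechet_derivative_at)

lemma smooth_on_open_linear:
  fixes G :: "'a::euclidean_space \<Rightarrow> 'b::euclidean_space"
  assumes "linear G"
  shows "smooth_on_open G UNIV"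
proof -
  have G: "bounded_linear G" using assms by (simp add: linear_conv_bounded_linear)
  have "Ck_on k G UNIV" for k
    by (cases k) (auto simp: linear_continuous_on[OF G] frechet_derivative_bounded_linear[OF G]
      Ck_on_const bounded_linear_imp_differentiable[OF G])
  then show ?thesis by (simp add: smooth_on_open_def)
qed

text \<open>The family is closed under differentiation, so the induction on the order must leave
  \<open>U\<close>, \<open>V\<close>, \<open>W\<close> free. Rodrigues curves have this
  shape.\<close>

lemma Ck_on_trig:
  "Ck_on k (\<lambda>t::real. U + sin t *\<^sub>R V + cos t *\<^sub>R (W::'a::euclidean_space)) S"
proof (induction k arbitrary: U V W)
  case 0
  then show ?case by (auto intro!: continuous_intros)
next
  case (Suc k)
  have d: "((\<lambda>t::real. U + sin t *\<^sub>R V + cos t *\<^sub>R W) has_derivative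
      (\<lambda>v. v *\<^sub>R (cos t *\<^sub>R V - sin t *\<^sub>R W))) (at t)" for t
    by (auto intro!: derivative_eq_intros simp: algebra_simps)
  have "(\<lambda>t. frechet_derivative (\<lambda>t::real. U + sin t *\<^sub>R V + cos t *\<^sub>R W) (at t) v) =
      (\<lambda>t. 0 + sin t *\<^sub>R (- v *\<^sub>R W) + cos t *\<^sub>R (v *\<^sub>R V))" for v
    using frechet_derivative_at[OF d] by (auto simp: fun_eq_iff algebra_simps dest: sym)
  then show ?case using Suc[of 0 "- v *\<^sub>R W" "v *\<^sub>R V" for v] d
    by (auto simp: differentiable_def simp del: scaleR_minus_left)
qed

text \<open>The linear map is itself a smooth extension of \<open>f\<close> near every point, so the
  differential of \<open>f\<close> is \<open>G\<close> on tangent vectors; \<open>H\<close> does the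
  same for the inverse.\<close>

lemma riemannian_isometry_linear:
  fixes G H :: "'a::euclidean_space \<Rightarrow> 'a"
  assumes G: "linear G" "\<And>x. x \<in> M \<Longrightarrow> G x \<in> M" and H: "linear H" "\<And>x. x \<in> M \<Longrightarrow> H x \<in> M"
    and HG: "\<And>x. x \<in> M \<Longrightarrow> H (G x) = x" and GH: "\<And>x. x \<in> M \<Longrightarrow> G (H x) = x"
    and f: "\<And>x. x \<in> M \<Longrightarrow> f x = G x"
    and g: "\<And>p u v. g (G p) (G u) (G v) = g p u v"
  shows "riemannian_isometry M g f"
proof -
  have bij: "bij_betw f M M"
    by (rule bij_betw_byWitness[where f' = H]) (auto simp: f G H HG GH)
  have inv: "inv_into M f x = H x" if "x \<in> M" for x
    using bij that by (intro inv_into_f_eq) (auto simp: bij_betw_def f H GH)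
  have sm: "smooth_map_on M h" if "linear L" "\<And>x. x \<in> M \<Longrightarrow> h x = L x" for h L :: "'a \<Rightarrow> 'a"
    unfolding smooth_map_on_def
    by (intro ballI exI[of _ UNIV] exI[of _ L]) (auto simp: that smooth_on_open_linear)
  have "differential M f p v = G v" if "v \<in> tangent_space M p" for p v
    using differential_eq[OF smooth_on_open_linear[OF G(1)] UNIV_I _ that, of f]
      frechet_derivative_bounded_linear[of G] G(1)
    by (simp add: f linear_conv_bounded_linear)
  then show ?thesis
    unfolding riemannian_isometry_def diffeomorphism_of_def
    using bij sm[OF G(1) f] sm[OF H(1) inv] by (auto simp: g f)
qed

section \<open>One-parameter subgroups through unitary matrices\<close>

text \<open>A minimizer of the Rayleigh quotient on the unit sphere is an eigenvector. The lower
  bound for all \<open>y\<close> is kept because later arguments need the eigenvalue to be the least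
  one.\<close>

lemma selfadjoint_min_eigenvector:
  fixes S :: "'a::euclidean_space \<Rightarrow> 'a"
  assumes "linear S" and sym: "\<And>x y. inner (S x) y = inner x (S y)"
  obtains x \<mu> where "norm x = 1" "S x = \<mu> *\<^sub>R x" "\<And>y. \<mu> * (norm y)\<^sup>2 \<le> inner y (S y)"
proof -
  interpret S: linear S by fact
  have "continuous_on (sphere 0 1) (\<lambda>x. inner x (S x))"
    by (intro continuous_intros linear_continuous_on linear_conv_bounded_linear[THEN iffD1] \<open>linear S\<close>)
  then obtain x where x: "norm x = 1" and min: "\<And>y. norm y = 1 \<Longrightarrow> inner x (S x) \<le> inner y (S y)"
    using continuous_attains_inf[of "sphere 0 1" "\<lambda>x. inner x (S x)"] by auto
  define \<mu> where "\<mu> = inner x (S x)"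
  define q where "q y = inner y (S y) - \<mu> * (norm y)\<^sup>2" for y
  have q: "q y \<ge> 0" for y
  proof (cases "y = 0")
    case False
    have "\<mu> \<le> inner (y /\<^sub>R norm y) (S (y /\<^sub>R norm y))"
      unfolding \<mu>_def by (rule min) (simp add: False)
    then show ?thesis using False
      by (simp add: S.scaleR q_def field_simps power2_eq_square)
  qed (simp add: q_def S.zero)
  define r where "r = S x - \<mu> *\<^sub>R x"
  have qt: "q (x + t *\<^sub>R r) = 2 * t * (norm r)\<^sup>2 + t\<^sup>2 * q r" for t
  proof -
    have "inner x (S r) = inner r (S x)" using sym by (metis inner_commute)
    moreover have "inner x x = 1" using x by (simp add: norm_eq_1)
    moreover have "inner r r = inner r (S x) - \<mu> * inner r x"
      by (simp add: r_def inner_diff_right)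
    ultimately have "inner r (S x) = inner r r + \<mu> * inner r x"
      "inner x (S r) = inner r r + \<mu> * inner r x" "inner x x = 1"
      by simp_all
    then show ?thesis
      unfolding q_def power2_norm_eq_inner S.add S.scaleR
      by (simp add: inner_add_left inner_add_right inner_commute[of x r] \<mu>_def[symmetric]
          algebra_simps power2_eq_square)
  qed
  have "r = 0"
  proof (rule ccontr)
    assume "r \<noteq> 0"
    define N where "N = (norm r)\<^sup>2"
    have N: "N > 0" using \<open>r \<noteq> 0\<close> by (simp add: N_def)
    define Q where "Q = q r"
    have Q: "Q \<ge> 0" using q by (simp add: Q_def)
    \<comment> \<open>The form \<open>q\<close> is nonnegative, and along
      \<open>x + t *\<^sub>R r\<close> it has the linear term \<open>2 * t * N\<close>. At
      \<open>t = - N / d\<close> its value is negative; adding 1 to \<open>Q\<close> keeps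
      \<open>d\<close> positive.\<close>
    define d where "d = Q + 1"
    have d: "d > 0" "Q = d - 1" using Q by (simp_all add: d_def)
    have "0 \<le> 2 * (- N / d) * N + (- N / d)\<^sup>2 * Q"
      using q[of "x + (- N / d) *\<^sub>R r"] unfolding qt N_def Q_def .
    also have "\<dots> = - (N\<^sup>2 * (d + 1)) / d\<^sup>2"
      unfolding d(2) using d(1) by (simp add: field_simps power2_eq_square)
    also have "\<dots> < 0" using N d(1) by (simp add: divide_neg_pos)
    finally show False by simp
  qed
  then have "S x = \<mu> *\<^sub>R x" by (simp add: r_def)
  with x q show ?thesis by (intro that[of x \<mu>]) (simp_all add: q_def)
qed

lemma norm_unitary_matvec: "U \<in> unitary_group \<Longrightarrow> norm (U *v x) = norm x"
  by (metis Re_hdot hdot_unitary norm_eq_sqrt_inner)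

lemma smult_eq_scaleR: "complex_of_real r *s x = r *\<^sub>R x" for x :: "complex^'n"
  by (simp add: vec_eq_iff scaleR_conv_of_real[where 'a=complex])

lemma normalize_eigenvector:
  fixes x :: "complex^'n"
  assumes "x \<noteq> 0" "A *v x = z *s x"
  obtains u where "norm u = 1" "A *v u = z *s u"
proof (rule that[of "complex_of_real (1 / norm x) *s x"])
  show "norm (complex_of_real (1 / norm x) *s x) = 1"
    using assms(1) unfolding norm_smult_complex by (simp add: norm_divide)
  show "A *v (complex_of_real (1 / norm x) *s x) = z *s (complex_of_real (1 / norm x) *s x)"
    by (simp add: vector_scalar_commute assms(2))
qed

text \<open>The least eigenvalue \<open>m\<close> of the self-adjoint matrix
  \<open>U + adjoint_mat U\<close> is below 2 unless \<open>U\<close> is the identity. On its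
  eigenvector, \<open>U\<close> satisfies a real quadratic equation whose roots are unimodular with
  real part \<open>m/2\<close>, hence different from 1.\<close>

lemma unitary_eigenvector:
  fixes U :: "complex^'n^'n"
  assumes U: "U \<in> unitary_group" "U \<noteq> mat 1"
  obtains x \<theta> where "norm x = 1" "U *v x = cis \<theta> *s x" "cis \<theta> \<noteq> 1"
proof -
  have inner_adj: "inner (A *v x) y = inner x (adjoint_mat A *v y)" for A :: "complex^'n^'n" and x y
    by (metis Re_hdot hdot_matvec)
  obtain x m where x: "norm x = 1" "(U + adjoint_mat U) *v x = m *\<^sub>R x"
    and min: "\<And>y. m * (norm y)\<^sup>2 \<le> inner y ((U + adjoint_mat U) *v y)"
    by (rule selfadjoint_min_eigenvector[of "\<lambda>y. (U + adjoint_mat U) *v y"])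
       (auto simp: inner_adj adjoint_mat_simps add.commute)
  have two: "inner y ((U + adjoint_mat U) *v y) = 2 * inner y (U *v y)" for y
    by (simp add: matvec.add_left inner_add_right inner_adj[symmetric] inner_commute)
  have "m < 2"
  proof (rule ccontr)
    assume m: "\<not> m < 2"
    have "U *v y = y" for y
    proof -
      have "2 * (norm y)\<^sup>2 \<le> m * (norm y)\<^sup>2" using m by (intro mult_right_mono) auto
      then have "(norm y)\<^sup>2 \<le> inner y (U *v y)" using min[of y] two[of y] by linarith
      moreover have "(norm (U *v y - y))\<^sup>2 = 2 * (norm y)\<^sup>2 - 2 * inner y (U *v y)"
        using norm_unitary_matvec[OF U(1), of y]
        by (simp add: power2_norm_eq_inner inner_diff inner_commute norm_eq)
      ultimately have "(norm (U *v y - y))\<^sup>2 \<le> 0" by linarith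
      then show ?thesis by simp
    qed
    then have "U = mat 1" by (intro matrix_eqI) simp
    with U(2) show False by simp
  qed
  have "\<bar>inner x (U *v x)\<bar> \<le> 1"
    using Cauchy_Schwarz_ineq2[of x "U *v x"] x(1) norm_unitary_matvec[OF U(1)] by simp
  moreover have "m = 2 * inner x (U *v x)"
    using two[of x] x by (simp add: norm_eq_1)
  ultimately have "m \<ge> -2" by linarith
  \<comment> \<open>One root of the polynomial z^2 - m z + 1; the other is its conjugate.\<close>
  define z where "z = Complex (m/2) (sqrt (1 - (m/2)\<^sup>2))"
  have "(m/2)\<^sup>2 \<le> 1" using \<open>m < 2\<close> \<open>m \<ge> -2\<close> by (simp add: abs_square_le_1 abs_le_iff)
  then have z1: "cmod z = 1" by (simp add: z_def cmod_def)
  then have zz: "z * cnj z = 1" by (simp add: complex_norm_square[symmetric])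
  have zm: "z + cnj z = complex_of_real m" by (simp add: z_def complex_eq_iff)
  have Ux: "U *v (U *v x) = complex_of_real m *s (U *v x) - x"
  proof -
    have "U *v ((U + adjoint_mat U) *v x) = U *v (U *v x) + x"
      by (simp add: matvec.add_left matvec.add_right matrix_vector_mul_assoc unitary_groupD U(1))
    then show ?thesis
      unfolding x(2) matvec.scaleR_right smult_eq_scaleR by (simp add: algebra_simps)
  qed
  \<comment> \<open>The factor \<open>U - cnj z\<close> maps \<open>x\<close> into the eigenspace of
    \<open>z\<close>; if it annihilates \<open>x\<close>, then \<open>x\<close> is an eigenvector
    for \<open>cnj z\<close>.\<close>
  define y where "y = U *v x - cnj z *s x"
  have "U *v y = z *s y"
    unfolding y_def matvec.diff_right vector_scalar_commute Ux zm[symmetric]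
    by (simp add: vec_eq_iff algebra_simps zz)
  have Re: "Re z < 1" using \<open>m < 2\<close> by (simp add: z_def)
  obtain u w where u: "norm u = 1" "U *v u = w *s u" "w = z \<or> w = cnj z"
  proof (cases "y = 0")
    case True
    then show ?thesis using that[of x "cnj z"] x(1) by (simp add: y_def)
  next
    case False
    then show ?thesis using normalize_eigenvector[OF False \<open>U *v y = z *s y\<close>] that by blast
  qed
  have "w = cis (Arg w)" using u(3) z1 cis_Arg[of w] by (force simp: sgn_div_norm)
  moreover have "w \<noteq> 1" using u(3) Re by auto
  ultimately show ?thesis using that[of u "Arg w"] u by metis
qed

text \<open>This is exp(t K) whenever K^3 = -K, as for unit dyads; its period 2 pi is then
  visible.\<close>

definition rodrigues :: "complex^'n^'n \<Rightarrow> real \<Rightarrow> complex^'n^'n" where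
  "rodrigues K t = mat 1 + sin t *\<^sub>R K + (1 - cos t) *\<^sub>R (K ** K)"

lemma rodrigues_0 [simp]: "rodrigues K 0 = mat 1"
  by (simp add: rodrigues_def)

lemma adjoint_rodrigues: "K \<in> skew \<Longrightarrow> adjoint_mat (rodrigues K t) = rodrigues K (- t)"
  by (simp add: rodrigues_def adjoint_mat_simps adjoint_mat_mult skew_def matmul.minus_left
      matmul.minus_right)

lemma rodrigues_inverse:
  assumes K: "K ** (K ** K) = - K"
  shows "rodrigues K t ** rodrigues K (- t) = mat 1"
proof -
  have sq: "(sin t)\<^sup>2 = 1 - (cos t)\<^sup>2" by (simp add: sin_squared_eq)
  have K4: "K ** K ** (K ** K) = - (K ** K)"
    using K by (metis matrix_mul_assoc matmul.minus_right)
  have "rodrigues K t ** rodrigues K (- t) =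
     mat 1 + (2 * (1 - cos t) - (1 - cos t)\<^sup>2 - (sin t)\<^sup>2) *\<^sub>R (K ** K)"
    by (simp add: rodrigues_def matmul.add_left matmul.add_right matmul.scaleR_left
        matmul.scaleR_right matmul.minus_right matmul.diff_left matmul.diff_right K K4 
        matrix_mul_assoc[symmetric] algebra_simps power2_eq_square flip: scaleR_add_left)
  also have "2 * (1 - cos t) - (1 - cos t)\<^sup>2 - (sin t)\<^sup>2 = 0"
    unfolding sq by (simp add: power2_eq_square algebra_simps)
  finally show ?thesis by simp
qed

lemma rodrigues_unitary:
  assumes K: "K \<in> skew" "K ** (K ** K) = - K"
  shows "rodrigues K t \<in> unitary_group"
  using rodrigues_inverse[OF K(2), of t] rodrigues_inverse[OF K(2), of "- t"]
  by (simp add: unitary_group_def adjoint_rodrigues K(1))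

lemma rodrigues_deriv:
  assumes K: "K ** (K ** K) = - K"
  shows "(rodrigues K has_vector_derivative rodrigues K t ** K) (at t)"
proof -
  have "rodrigues K t ** K = cos t *\<^sub>R K + sin t *\<^sub>R (K ** K)"
    by (simp add: rodrigues_def matmul.add_left matmul.diff_left matmul.scaleR_left K
        matrix_mul_assoc[symmetric] scaleR_diff_left)
  moreover have "((\<lambda>t. mat 1 + sin t *\<^sub>R K + (1 - cos t) *\<^sub>R (K ** K)) has_vector_derivative
      cos t *\<^sub>R K + sin t *\<^sub>R (K ** K)) (at t)"
    by (auto intro!: derivative_eq_intros simp: has_real_derivative_iff_has_vector_derivative[symmetric])
  ultimately show ?thesis unfolding rodrigues_def[abs_def] by simp
qed

lemma rodrigues_dyad_matvec:
  assumes "norm x = 1"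
  shows "rodrigues (skew_dyad x) t *v x = cis t *s x"
    and "hdot x y = 0 \<Longrightarrow> rodrigues (skew_dyad x) t *v y = y"
proof -
  have h: "hdot x x = 1" using assms by (simp add: hdot_self)
  have *: "rodrigues (skew_dyad x) t *v y = y + sin t *\<^sub>R ((\<i> * hdot x y) *s x) -
     (1 - cos t) *\<^sub>R (hdot x y *s x)" for y
    by (simp add: rodrigues_def matvec.add_left matvec.scaleR_left matrix_vector_mul_assoc[symmetric]
        skew_dyad_matvec hdot_smult h vec_eq_iff)
  show "rodrigues (skew_dyad x) t *v x = cis t *s x"
    unfolding * h by (simp add: vec_eq_iff scaleR_conv_of_real[where 'a=complex] complex_eq_iff algebra_simps)
  show "hdot x y = 0 \<Longrightarrow> rodrigues (skew_dyad x) t *v y = y"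
    unfolding * by simp
qed

text \<open>Removing one eigenvalue of \<open>U\<close> enlarges the space of fixed vectors, so the induction is on
  its dimension.\<close>

lemma unitary_one_parameter:
  fixes U :: "complex^'n^'n"
  assumes "U \<in> unitary_group"
  shows "\<exists>X c. X \<in> skew \<and> (\<forall>t. c t \<in> unitary_group) \<and> c 0 = mat 1 \<and> c 1 = U \<and>
    (\<forall>t. (c has_vector_derivative c t ** X) (at t)) \<and> (\<forall>y. U *v y = y \<longrightarrow> X *v y = 0)"
  using assms
proof (induction U rule: measure_induct_rule[where f = "\<lambda>U. DIM(complex^'n) - dim {y. U *v y = y}"])
  case (less U)
  show ?case
  proof (cases "U = mat 1")
    case True
    then show ?thesis
      by (intro exI[of _ 0] exI[of _ "\<lambda>_. mat 1"])
         (auto simp: subspace_0[OF subspace_skew] unitary_group_one)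
  next
    case False
    obtain x \<theta> where x: "norm x = 1" "U *v x = cis \<theta> *s x" "cis \<theta> \<noteq> 1"
      using unitary_eigenvector[OF less.prems False] .
    define K where "K = skew_dyad x"
    have K: "K \<in> skew" "K ** (K ** K) = - K"
      by (simp_all add: K_def skew_dyad_skew unit_skew_dyad_cube x(1))
    \<comment> \<open>The Rodrigues factor multiplies \<open>x\<close> by
      \<open>cis (- \<theta>)\<close>, undoing the eigenvalue, and is the identity on the orthogonal
      complement of \<open>x\<close>.\<close>
    define U' where "U' = U ** rodrigues K (- \<theta>)"
    have U': "U' \<in> unitary_group"
      by (simp add: U'_def unitary_group_mult less.prems rodrigues_unitary K)
    have orth: "hdot x y = 0" if "U *v y = y" for y
    proof -
      have "hdot x y = hdot (U *v x) (U *v y)" by (simp add: hdot_unitary less.prems)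
      also have "\<dots> = cis (- \<theta>) * hdot x y" by (simp add: x that hdot_smult cis_cnj)
      finally have "hdot x y = 0 \<or> cis (- \<theta>) = 1" by auto
      moreover have "cis (- \<theta>) \<noteq> 1" using x(3) by (metis cis_cnj complex_cnj_cancel_iff complex_cnj_one)
      ultimately show ?thesis by simp
    qed
    have fix': "U' *v y = y" if "U *v y = y" for y
      using orth[OF that] that
      by (simp add: U'_def matrix_vector_mul_assoc[symmetric] K_def rodrigues_dyad_matvec x(1))
    have fixx: "U' *v x = x"
      by (simp add: U'_def matrix_vector_mul_assoc[symmetric] K_def rodrigues_dyad_matvec x(1)
          vector_scalar_commute x(2) cis_mult)
    have sub: "subspace {y. A *v y = y}" for A :: "complex^'n^'n"
      by (auto simp: subspace_def matvec.add_right matvec.scaleR_right)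
    have "U *v x \<noteq> x"
    proof
      assume "U *v x = x"
      then have "hdot x x = 0" by (rule orth)
      then show False using x(1) by (simp add: hdot_self)
    qed
    then have "{y. U *v y = y} \<subset> {y. U' *v y = y}" using fix' fixx by blast
    then have "dim {y. U *v y = y} < dim {y. U' *v y = y}"
      by (intro dim_psubset) (simp add: span_eq_iff[THEN iffD2, OF sub])
    moreover have "dim {y. U' *v y = y} \<le> DIM(complex^'n)" by (rule dim_subset_UNIV)
    ultimately have "DIM(complex^'n) - dim {y. U' *v y = y} < DIM(complex^'n) - dim {y. U *v y = y}"
      by linarith
    from less.IH[OF this U'] obtain X c where X: "X \<in> skew"
      and c: "\<And>t. c t \<in> unitary_group" "c 0 = mat 1" "c 1 = U'"
        "\<And>t. (c has_vector_derivative c t ** X) (at t)"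
      and kill: "\<And>y. U' *v y = y \<Longrightarrow> X *v y = 0"
      by blast
    \<comment> \<open>Here the last clause of the claim is used: \<open>X\<close> kills the fixed
      vectors of \<open>U'\<close>, among them \<open>x\<close>. Thus \<open>X\<close> and
      \<open>K\<close> annihilate each other, and the product of the two curves is again
      one-parameter, with generator \<open>X + \<theta> *\<^sub>R K\<close>.\<close>
    have XK: "X ** K = 0"
      by (rule matrix_eqI)
         (simp add: matrix_vector_mul_assoc[symmetric] K_def skew_dyad_matvec vector_scalar_commute
           kill[OF fixx])
    have "K ** X = 0"
    proof -
      have "K ** X = adjoint_mat (X ** K)"
        using X K(1) by (simp add: adjoint_mat_mult skew_def matmul.minus_left matmul.minus_right)
      then show ?thesis by (simp add: XK adjoint_mat_simps)
    qed
    define R where "R t = rodrigues K (t * \<theta>)" for t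
    have "((\<lambda>t. t * \<theta>) has_vector_derivative \<theta>) (at t)" for t
      by (auto intro!: derivative_eq_intros
          simp flip: has_real_derivative_iff_has_vector_derivative)
    then have dR: "(R has_vector_derivative \<theta> *\<^sub>R (R t ** K)) (at t)" for t
      unfolding R_def[abs_def]
      using vector_diff_chain_at[OF _ rodrigues_deriv[OF K(2)], of "\<lambda>t. t * \<theta>" \<theta> t]
      by (simp add: o_def)
    have XR: "X ** R t = X" and RX: "R t ** X = X" for t
      using XK \<open>K ** X = 0\<close>
      by (simp_all add: R_def rodrigues_def matmul.add_left matmul.add_right matmul.scaleR_left
          matmul.scaleR_right matrix_mul_assoc[of X K K] matrix_mul_assoc[of K K X, symmetric])
    have "((\<lambda>t. c t ** R t) has_vector_derivative c t ** R t ** (X + \<theta> *\<^sub>R K)) (at t)" for t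
      using matmul.has_vector_derivative[OF c(4)[of t] dR[of t]]
      by (simp add: matmul.add_right matmul.scaleR_right matrix_mul_assoc[symmetric] XR RX add.commute)
    moreover have "c 1 ** R 1 = U"
      using rodrigues_inverse[OF K(2), of "- \<theta>"]
      by (simp add: c U'_def R_def matrix_mul_assoc[symmetric])
    moreover have "(X + \<theta> *\<^sub>R K) *v y = 0" if "U *v y = y" for y
      using kill[OF fix'[OF that]] orth[OF that]
      by (simp add: matvec.add_left matvec.scaleR_left K_def skew_dyad_matvec)
    moreover have "X + \<theta> *\<^sub>R K \<in> skew"
      by (intro subspace_add subspace_scale subspace_skew X K)
    moreover have "c 0 ** R 0 = mat 1" by (simp add: c R_def)
    moreover have "c t ** R t \<in> unitary_group" for t
      by (simp add: c R_def unitary_group_mult rodrigues_unitary K)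
    ultimately show ?thesis
      by (intro exI[of _ "X + \<theta> *\<^sub>R K"] exI[of _ "\<lambda>t. c t ** R t"] conjI allI impI) auto
  qed
qed

section \<open>Isometries preserve geodesics\<close>

lemma bilinear_form_eq_on_span:
  assumes L: "linear L" "linear L'" "linear M" "linear M'"
    and eq: "\<And>x y. x \<in> S \<Longrightarrow> y \<in> S \<Longrightarrow> inner (L x) (M y) = inner (L' x) (M' y)"
    and xy: "x \<in> span S" "y \<in> span S"
  shows "inner (L x) (M y) = inner (L' x) (M' y)"
proof -
  note lin = linear_compose[OF _ bounded_linear.linear[OF bounded_linear_inner_left], unfolded o_def]
    linear_compose[OF _ bounded_linear.linear[OF bounded_linear_inner_right], unfolded o_def]
  have "inner (L x) (M y) = inner (L' x) (M' y)" if "x \<in> S" for x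
    by (rule linear_eq_on[OF lin(2)[OF L(3)] lin(2)[OF L(4)] xy(2)]) (rule eq[OF that])
  then show ?thesis
    by (intro linear_eq_on[OF lin(1)[OF L(1)] lin(1)[OF L(2)] xy(1)])
qed

text \<open>Transfers facts checked along Rodrigues curves to all skew-Hermitian matrices;
  \<open>W\<close> is later either \<open>skew\<close> or the zero space.\<close>

lemma skew_linear_induct:
  fixes X :: "complex^'n^'n"
  assumes "linear L" "subspace W" "X \<in> skew" and "\<And>v. norm v = 1 \<Longrightarrow> L (skew_dyad v) \<in> W"
  shows "L X \<in> W"
proof -
  have "span (skew_dyad ` {v. norm v = 1}) \<subseteq> L -` W"
    using assms by (intro span_minimal linear_subspace_vimage) auto
  then show ?thesis using skew_subset_span assms(3) by blast
qed

lemma linear_matmul: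
  fixes A :: "complex^'n^'n"
  shows "linear (\<lambda>X :: complex^'n^'n. A ** X)" "linear (\<lambda>X :: complex^'n^'n. X ** A)"
  by (auto intro!: linearI
      simp: matmul.add_left matmul.add_right matmul.scaleR_left matmul.scaleR_right)

lemma unitary_curve_velocity_skew:
  fixes \<gamma> :: "real \<Rightarrow> complex^'n^'n"
  assumes "\<And>t. \<gamma> t \<in> unitary_group" and d: "(\<gamma> has_vector_derivative v) (at t)"
  shows "adjoint_mat (\<gamma> t) ** v \<in> skew"
proof -
  have "((\<lambda>t. adjoint_mat (\<gamma> t) ** \<gamma> t) has_vector_derivative
      adjoint_mat (\<gamma> t) ** v + adjoint_mat v ** \<gamma> t) (at t)"
    by (rule matmul.has_vector_derivative[OF bounded_linear.has_vector_derivative[OF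
          bounded_linear_adjoint_mat d] d])
  moreover have "(\<lambda>t. adjoint_mat (\<gamma> t) ** \<gamma> t) = (\<lambda>t. mat 1)"
    using assms(1) by (simp add: unitary_groupD)
  ultimately have "adjoint_mat (\<gamma> t) ** v + adjoint_mat v ** \<gamma> t = 0"
    by (metis has_vector_derivative_const vector_derivative_unique_at)
  then show ?thesis
    by (simp add: skew_def adjoint_mat_mult eq_neg_iff_add_eq_0 add.commute)
qed

text \<open>Hermitian and skew-Hermitian matrices are orthogonal for the real inner product, so
  \<open>W\<close> is tested against its own skew part.\<close>

lemma skew_orthogonal_hermitian:
  fixes W :: "complex^'n^'n"
  assumes "\<And>Y. Y \<in> skew \<Longrightarrow> inner W Y = 0"
  shows "adjoint_mat W = W"
proof -
  let ?Y = "W - adjoint_mat W"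
  have "?Y \<in> skew" by (simp add: skew_def adjoint_mat_simps)
  then have W: "inner W ?Y = 0" by (rule assms)
  have "inner (adjoint_mat W) ?Y = inner W (adjoint_mat ?Y)"
    by (metis inner_adjoint_mat adjoint_adjoint_mat)
  also have "\<dots> = - inner W ?Y" by (simp add: adjoint_mat_simps inner_diff_right)
  finally have "inner ?Y ?Y = 0" using W by (simp add: inner_diff_left)
  then show ?thesis by simp
qed

text \<open>Infinitesimal bi-invariance of the metric: bracketing with \<open>X\<close> is a
  skew-adjoint operation that kills \<open>X\<close>.\<close>

lemma inner_commutator_left:
  assumes "X \<in> skew" "Y \<in> skew"
  shows "inner (X ** Y - Y ** X) X = 0"
proof -
  have "inner (X ** Y) X = - inner Y (X ** X)" "inner (Y ** X) X = - inner Y (X ** X)"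
    using assms(1) by (simp add: inner_matmul_left skew_def matmul.minus_left,
        simp add: inner_matmul_right skew_def matmul.minus_right)
  then show ?thesis by (simp add: inner_diff_left)
qed

text \<open>Exhibits enough tangent vectors: those of the form \<open>A ** skew_dyad v\<close> with
  unit \<open>v\<close> already span \<open>A ** X\<close> for \<open>X\<close> in
  \<open>skew\<close>.\<close>

lemma curve_velocity_rodrigues:
  assumes A: "A \<in> unitary_group" and v: "norm v = 1"
  shows "curve_velocity unitary_group A (A ** skew_dyad v) (\<lambda>t. A ** rodrigues (skew_dyad v) t)"
proof -
  let ?K = "skew_dyad v"
  note K = skew_dyad_skew[of v] unit_skew_dyad_cube[OF v]
  have "(\<lambda>t. A ** rodrigues ?K t) =
      (\<lambda>t. (A + A ** (?K ** ?K)) + sin t *\<^sub>R (A ** ?K) + cos t *\<^sub>R (- (A ** (?K ** ?K))))"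
    by (simp add: fun_eq_iff rodrigues_def matmul.add_right matmul.diff_right matmul.scaleR_right
        algebra_simps)
  then have "smooth_on_open (\<lambda>t. A ** rodrigues ?K t) {-1<..<1}"
    unfolding smooth_on_open_def by (simp add: Ck_on_trig del: scaleR_minus_right)
  moreover have "((\<lambda>t. A ** rodrigues ?K t) has_vector_derivative A ** ?K) (at 0)"
    using bounded_linear.has_vector_derivative[OF matmul.bounded_linear_right rodrigues_deriv[OF K(2), of 0]]
    by simp
  moreover have "A ** rodrigues ?K t \<in> unitary_group" for t
    by (intro unitary_group_mult A rodrigues_unitary K)
  ultimately show ?thesis
    unfolding curve_velocity_def by (auto intro!: exI[of _ 1])
qed

lemma isometry_unitary:
  "riemannian_isometry unitary_group g f \<Longrightarrow> A \<in> unitary_group \<Longrightarrow> f A \<in> unitary_group"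
  unfolding riemannian_isometry_def diffeomorphism_of_def bij_betw_def by blast

section \<open>First and second order properties of a local smooth extension of an isometry\<close>

context
  fixes f F :: "complex^'n^'n \<Rightarrow> complex^'n^'n" and V
  assumes iso: "riemannian_isometry unitary_group frobenius_metric f"
    and F: "smooth_on_open F V" and FV: "\<And>x. x \<in> V \<inter> unitary_group \<Longrightarrow> F x = f x"
begin

lemma isometry_linear_differential:
  assumes "p \<in> V"
  shows "linear (\<lambda>X. frechet_derivative F (at p) (p ** X))"
  using linear_compose[OF linear_matmul(1) smooth_linear_frechet_derivative[OF F assms]]
  by (simp add: o_def)

text \<open>On unit dyads the derivative of \<open>F\<close> is the intrinsic differential of
  \<open>f\<close>, which preserves the metric; both sides are bilinear, so spanning gives the
  rest.\<close>

lemma isometry_inner: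
  assumes p: "p \<in> V" "p \<in> unitary_group" and XY: "X \<in> skew" "Y \<in> skew"
  shows "inner (frechet_derivative F (at p) (p ** X)) (frechet_derivative F (at p) (p ** Y)) = inner X Y"
proof (rule bilinear_form_eq_on_span[of _ id _ id, simplified])
  show "X \<in> span (skew_dyad ` {v. norm v = 1})" "Y \<in> span (skew_dyad ` {v. norm v = 1})"
    using XY skew_subset_span by auto
next
  have tan: "p ** skew_dyad v \<in> tangent_space unitary_group p" if "norm v = 1" for v
    unfolding tangent_space_def using curve_velocity_rodrigues[OF p(2) that] by blast
  have D: "frechet_derivative F (at p) (p ** skew_dyad v) = differential unitary_group f p (p ** skew_dyad v)"
    if "norm v = 1" for v
    by (rule differential_eq[OF F p(1) FV tan[OF that], symmetric])
  fix X Y :: "complex^'n^'n"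
  assume "X \<in> skew_dyad ` {v. norm v = 1}" "Y \<in> skew_dyad ` {v. norm v = 1}"
  then obtain v w where v: "X = skew_dyad v" "norm v = 1" and w: "Y = skew_dyad w" "norm w = 1"
    by blast
  have "inner (differential unitary_group f p (p ** X)) (differential unitary_group f p (p ** Y)) =
      inner (p ** X) (p ** Y)"
    using iso p(2) tan[OF v(2)] tan[OF w(2)]
    unfolding riemannian_isometry_def frobenius_metric_eq_inner v(1) w(1) by blast
  then show "inner (frechet_derivative F (at p) (p ** X)) (frechet_derivative F (at p) (p ** Y)) = inner X Y"
    by (simp add: v w D inner_unitary_left p(2))
qed (use isometry_linear_differential[OF p(1)] in \<open>auto intro: linear_id\<close>)

lemma isometry_image_derivative:
  assumes p: "c t \<in> V" "\<And>t. c t \<in> unitary_group" and c: "(c has_vector_derivative v) (at t)"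
  shows "((\<lambda>t. f (c t)) has_vector_derivative frechet_derivative F (at (c t)) v) (at t)"
proof -
  have dF: "((\<lambda>t. F (c t)) has_vector_derivative frechet_derivative F (at (c t)) v) (at t)"
    using vector_derivative_diff_chain_within[OF c, of F] smooth_has_derivative[OF F p(1)]
      has_derivative_at_withinI by (force simp: o_def)
  have "open V" using F by (simp add: smooth_on_open_def)
  moreover have "isCont c t" using c has_vector_derivative_continuous by blast
  ultimately obtain T where T: "open T" "t \<in> T" "\<And>s. s \<in> T \<Longrightarrow> c s \<in> V"
    using p(1) unfolding continuous_at_open by metis
  show ?thesis
    using FV p(2) by (intro has_vector_derivative_transform_within_open[OF dF T(1,2)]) (simp add: T(3))
qed

text \<open>For a unit dyad, the image of a Rodrigues curve stays in the unitary group, so its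
  velocity pulls back to a skew matrix.\<close>

lemma isometry_differential_skew:
  assumes p: "p \<in> V" "p \<in> unitary_group" and X: "X \<in> skew"
  shows "adjoint_mat (f p) ** frechet_derivative F (at p) (p ** X) \<in> skew"
proof (rule skew_linear_induct[where L = "\<lambda>X. adjoint_mat (f p) ** frechet_derivative F (at p) (p ** X)"])
  show "linear (\<lambda>X. adjoint_mat (f p) ** frechet_derivative F (at p) (p ** X))"
    using linear_compose[OF isometry_linear_differential[OF p(1)] linear_matmul(1)]
    by (simp add: o_def)
  fix v :: "complex^'n" assume v: "norm v = 1"
  define c where "c t = p ** rodrigues (skew_dyad v) t" for t
  have c0: "c 0 = p" by (simp add: c_def)
  have cU: "c t \<in> unitary_group" for t
    by (simp add: c_def unitary_group_mult p rodrigues_unitary skew_dyad_skew unit_skew_dyad_cube v)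
  have "(c has_vector_derivative p ** skew_dyad v) (at 0)"
    using curve_velocity_rodrigues[OF p(2) v] by (simp add: curve_velocity_def c_def[abs_def])
  from unitary_curve_velocity_skew[OF _ isometry_image_derivative[OF _ cU this]]
  show "adjoint_mat (f p) ** frechet_derivative F (at p) (p ** skew_dyad v) \<in> skew"
    using p cU by (simp add: c0 isometry_unitary[OF iso])
qed (use X subspace_skew in auto)

text \<open>Koszul: with \<open>a Z X\<close> the second derivative of \<open>f\<close> along the left-invariant fields \<open>X\<close>,
  then \<open>Z\<close>, the form \<open>\<langle>a Z X, df Y\<rangle>\<close> is skew in \<open>X, Y\<close> because \<open>f\<close> is isometric, and its
  antisymmetric part in \<open>Z, X\<close> is \<open>\<langle>[Z, X], Y\<rangle>\<close>, which vanishes for \<open>Y = Z\<close> by bi-invariance.\<close>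

lemma isometry_acceleration_normal:
  assumes p: "p \<in> V" "p \<in> unitary_group" and XY: "X \<in> skew" "Y \<in> skew"
  shows "inner (fderiv2 F p (p ** X) (p ** X) + frechet_derivative F (at p) (p ** X ** X))
    (frechet_derivative F (at p) (p ** Y)) = 0"
proof -
  define D where "D X = frechet_derivative F (at p) (p ** X)" for X
  \<comment> \<open>The derivative of \<open>frechet_derivative F (at p) (p ** X)\<close> in
    direction \<open>p ** Z\<close>; the second summand comes from the dependence of
    \<open>p ** X\<close> on \<open>p\<close>.\<close>
  define a where "a Z X = fderiv2 F p (p ** Z) (p ** X) + D (Z ** X)" for Z X
  have linD: "linear D" using isometry_linear_differential[OF p(1)] by (simp add: D_def[abs_def])
  have lina: "linear (\<lambda>Z. a Z X)" for X
    unfolding a_def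
    by (intro linear_compose_add linear_compose[OF linear_matmul(1) linear_fderiv2(1)[OF F p(1)], unfolded o_def]
       linear_compose[OF linear_matmul(2) linD, unfolded o_def])
  \<comment> \<open>Metric compatibility: the inner product of the images of the fields
    \<open>X\<close> and \<open>Y\<close> is constant, and its derivative in direction
    \<open>Z\<close> vanishes.\<close>
  have skewXY: "inner (a Z X) (D Y) + inner (D X) (a Z Y) = 0"
    if Z: "Z \<in> skew" and X: "X \<in> skew" and Y: "Y \<in> skew" for X Y Z
  proof -
    have "inner (a Z X) (D Y) + inner (D X) (a Z Y) \<in> {0}"
    proof (rule skew_linear_induct[OF _ _ Z])
      show "linear (\<lambda>Z. inner (a Z X) (D Y) + inner (D X) (a Z Y))"
        by (intro linear_compose_add
          linear_compose[OF lina bounded_linear.linear[OF bounded_linear_inner_left], unfolded o_def]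
          linear_compose[OF lina bounded_linear.linear[OF bounded_linear_inner_right], unfolded o_def])
      fix v :: "complex^'n" assume v: "norm v = 1"
      define e where "e t = p ** rodrigues (skew_dyad v) t" for t
      have e0: "e 0 = p" by (simp add: e_def)
      have eU: "e t \<in> unitary_group" for t
        by (simp add: e_def unitary_group_mult p rodrigues_unitary skew_dyad_skew unit_skew_dyad_cube v)
      have de: "(e has_vector_derivative p ** skew_dyad v) (at 0)"
        using curve_velocity_rodrigues[OF p(2) v] by (simp add: curve_velocity_def e_def[abs_def])
      have d: "((\<lambda>t. frechet_derivative F (at (e t)) (e t ** X)) has_vector_derivative a (skew_dyad v) X) (at 0)" for X
        using has_vector_derivative_frechet_along_curve[OF F _ de
            bounded_linear.has_vector_derivative[OF matmul.bounded_linear_left de, of X]] p(1)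
        by (simp add: e0 a_def D_def matrix_mul_assoc)
      have d1: "((\<lambda>t. inner (frechet_derivative F (at (e t)) (e t ** X)) (frechet_derivative F (at (e t)) (e t ** Y)))
          has_vector_derivative inner (D X) (a (skew_dyad v) Y) + inner (a (skew_dyad v) X) (D Y)) (at 0)"
        using bounded_bilinear.has_vector_derivative[OF bounded_bilinear_inner d d, of X Y]
        by (simp add: e0 D_def)
      have "open V" using F by (simp add: smooth_on_open_def)
      moreover have "isCont e 0" using de has_vector_derivative_continuous by blast
      ultimately obtain T where T: "open T" "0 \<in> T" "\<And>t. t \<in> T \<Longrightarrow> e t \<in> V"
        using p(1) e0 unfolding continuous_at_open by metis
      have "((\<lambda>t. inner X Y) has_vector_derivative inner (D X) (a (skew_dyad v) Y) + inner (a (skew_dyad v) X) (D Y)) (at 0)"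
        by (rule has_vector_derivative_transform_within_open[OF d1 T(1,2)])
           (use T(3) eU X Y in \<open>auto intro: isometry_inner\<close>)
      then show "inner (a (skew_dyad v) X) (D Y) + inner (D X) (a (skew_dyad v) Y) \<in> {0}"
        using vector_derivative_unique_at[OF has_vector_derivative_const] by fastforce
    qed (rule subspace_single_0)
    then show ?thesis by simp
  qed
  \<comment> \<open>The symmetric \<open>fderiv2\<close> terms cancel. Unlike \<open>Z ** X\<close>,
    the remaining commutator is skew, so \<open>isometry_inner\<close> applies to it.\<close>
  have comm: "inner (a Z X) (D Y) - inner (a X Z) (D Y) = inner (Z ** X - X ** Z) Y"
    if Z: "Z \<in> skew" and X: "X \<in> skew" and Y: "Y \<in> skew" for X Y Z
  proof -
    have "Z ** X - X ** Z \<in> skew"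
      using X Z by (simp add: skew_def adjoint_mat_simps adjoint_mat_mult matmul.minus_left matmul.minus_right)
    then have "inner (D (Z ** X - X ** Z)) (D Y) = inner (Z ** X - X ** Z) Y"
      unfolding D_def by (intro isometry_inner p Y)
    moreover have "a Z X - a X Z = D (Z ** X - X ** Z)"
      by (simp add: a_def linear_diff[OF linD] fderiv2_symmetric[OF F p(1), of "p ** Z"])
    ultimately show ?thesis by (simp flip: inner_diff_left)
  qed
  have "inner (a X X) (D Y) = - inner (D X) (a X Y)"
    using skewXY[of X X Y] XY by simp
  also have "inner (D X) (a X Y) = inner (a Y X) (D X)"
    using comm[of X Y X] inner_commutator_left[of X Y] XY by (simp add: inner_commute)
  also have "inner (a Y X) (D X) = 0"
    using skewXY[of Y X X] XY by (simp add: inner_commute)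
  finally show ?thesis by (simp add: a_def D_def matrix_mul_assoc)
qed

text \<open>The pulled-back differential \<open>s\<close> is an isometry of the finite-dimensional
  space \<open>skew\<close> into itself, hence onto. Normality to the image of the differential is
  therefore orthogonality to every skew matrix.\<close>

lemma isometry_acceleration_hermitian:
  assumes p: "p \<in> V" "p \<in> unitary_group" and X: "X \<in> skew"
  defines "W \<equiv> adjoint_mat (f p) ** (fderiv2 F p (p ** X) (p ** X) + frechet_derivative F (at p) (p ** X ** X))"
  shows "adjoint_mat W = W"
proof (rule skew_orthogonal_hermitian)
  fix Y :: "complex^'n^'n" assume Y: "Y \<in> skew"
  define s where "s X = adjoint_mat (f p) ** frechet_derivative F (at p) (p ** X)" for X
  have fp: "f p \<in> unitary_group" by (rule isometry_unitary[OF iso p(2)])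
  have lin: "linear s"
    using linear_compose[OF isometry_linear_differential[OF p(1)] linear_matmul(1)]
    by (simp add: o_def s_def[abs_def])
  have "inner (s X) (s Y) = inner X Y" if "X \<in> skew" "Y \<in> skew" for X Y
    by (simp add: s_def inner_unitary_left unitary_group_adjoint fp isometry_inner p that)
  note inner_s = this
  have inj: "inj_on s skew"
  proof (rule inj_onI)
    fix X Y assume XY: "X \<in> skew" "Y \<in> skew" "s X = s Y"
    then have "X - Y \<in> skew" by (intro subspace_diff subspace_skew)
    then have "inner (X - Y) (X - Y) = inner (s (X - Y)) (s (X - Y))" by (simp add: inner_s)
    also have "s (X - Y) = 0" by (simp add: linear_diff[OF lin] XY)
    finally show "X = Y" by simp
  qed
  have into: "s ` skew \<subseteq> skew"
    using isometry_differential_skew[OF p] by (auto simp: s_def)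
  have dim: "dim (s ` skew) = dim (skew :: (complex^'n^'n) set)"
    by (rule eucl.dim_image_eq[OF lin]) (simp add: span_eq_iff[THEN iffD2, OF subspace_skew] inj)
  have "s ` skew = skew"
    by (rule subspace_dim_equal[OF linear_subspace_image[OF lin subspace_skew] subspace_skew into])
       (use dim in linarith)
  with Y have "Y \<in> s ` skew" by simp
  then obtain Z where Z: "Z \<in> skew" "s Z = Y" by (metis imageE)
  then show "inner W Y = 0"
    using isometry_acceleration_normal[OF p X Z(1)]
    by (auto simp: W_def s_def inner_unitary_left unitary_group_adjoint fp)
qed

end

text \<open>The velocity \<open>S t\<close> of the image curve, pulled back to the identity, is skew with Hermitian
  derivative, hence constant: isometries map one-parameter cosets to one-parameter cosets.\<close>

lemma isometry_geodesic:
  fixes f :: "complex^'n^'n \<Rightarrow> complex^'n^'n"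
  assumes iso: "riemannian_isometry unitary_group frobenius_metric f"
    and c: "\<And>t. c t \<in> unitary_group" "\<And>t. (c has_vector_derivative c t ** X) (at t)" and X: "X \<in> skew"
    and F: "smooth_on_open F V" "\<And>x. x \<in> V \<inter> unitary_group \<Longrightarrow> F x = f x" "c 0 \<in> V"
  shows "((\<lambda>t. f (c t)) has_vector_derivative
    f (c t) ** (adjoint_mat (f (c 0)) ** frechet_derivative F (at (c 0)) (c 0 ** X))) (at t)"
proof -
  \<comment> \<open>Local extensions are chosen separately at each time; the velocity
    \<open>\<gamma>'\<close> of the image curve does not depend on the choice.\<close>
  have "\<exists>G W. smooth_on_open G W \<and> (\<forall>x \<in> W \<inter> unitary_group. G x = f x) \<and> c t \<in> W" for t
    using iso c(1)[of t] unfolding riemannian_isometry_def diffeomorphism_of_def smooth_map_on_def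
    by metis
  then obtain G W where GW: "\<And>t. smooth_on_open (G t) (W t)"
    "\<And>t x. x \<in> W t \<inter> unitary_group \<Longrightarrow> G t x = f x" "\<And>t. c t \<in> W t"
    by metis
  note fU = isometry_unitary[OF iso c(1)]
  define \<gamma> where "\<gamma> t = f (c t)" for t
  have dg: "(\<gamma> has_vector_derivative frechet_derivative H (at (c t)) (c t ** X)) (at t)"
    if "smooth_on_open H U" "\<And>x. x \<in> U \<inter> unitary_group \<Longrightarrow> H x = f x" "c t \<in> U" for H U t
    unfolding \<gamma>_def[abs_def] by (rule isometry_image_derivative[OF iso that c])
  define \<gamma>' where "\<gamma>' t = vector_derivative \<gamma> (at t)" for t
  have \<gamma>'_eq: "\<gamma>' t = frechet_derivative H (at (c t)) (c t ** X)"
    if "smooth_on_open H U" "\<And>x. x \<in> U \<inter> unitary_group \<Longrightarrow> H x = f x" "c t \<in> U" for H U t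
    unfolding \<gamma>'_def by (rule vector_derivative_at[OF dg[OF that]])
  have d\<gamma>: "(\<gamma> has_vector_derivative \<gamma>' t) (at t)" for t
    using dg[OF GW] \<gamma>'_eq[OF GW] by metis
  define S where "S t = adjoint_mat (\<gamma> t) ** \<gamma>' t" for t
  have skewS: "S t \<in> skew" for t
    unfolding S_def by (rule unitary_curve_velocity_skew[OF _ d\<gamma>]) (simp add: \<gamma>_def fU)
  have "(S has_vector_derivative 0) (at t)" for t
  proof -
    let ?D = "frechet_derivative (G t)"
    define a where "a = fderiv2 (G t) (c t) (c t ** X) (c t ** X) + ?D (at (c t)) (c t ** X ** X)"
    have d1: "((\<lambda>s. ?D (at (c s)) (c s ** X)) has_vector_derivative a) (at t)"
      unfolding a_def
      by (rule has_vector_derivative_frechet_along_curve[OF GW(1,3) c(2)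
            bounded_linear.has_vector_derivative[OF matmul.bounded_linear_left c(2)]])
    have "open (W t)" using GW(1) by (simp add: smooth_on_open_def)
    moreover have "isCont c t" using c(2) has_vector_derivative_continuous by blast
    ultimately obtain T where T: "open T" "t \<in> T" "\<And>s. s \<in> T \<Longrightarrow> c s \<in> W t"
      using GW(3)[of t] unfolding continuous_at_open by metis
    have \<gamma>'T: "\<gamma>' s = ?D (at (c s)) (c s ** X)" if "s \<in> T" for s
      by (rule \<gamma>'_eq[OF GW(1)]) (use GW(2) T(3) that in auto)
    have d2: "(\<gamma>' has_vector_derivative a) (at t)"
      by (rule has_vector_derivative_transform_within_open[OF d1 T(1,2)])
         (simp add: \<gamma>'T)
    have dS: "(S has_vector_derivative adjoint_mat (\<gamma> t) ** a + adjoint_mat (\<gamma>' t) ** \<gamma>' t) (at t)"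
      unfolding S_def[abs_def]
      by (rule matmul.has_vector_derivative[OF bounded_linear.has_vector_derivative[OF
          bounded_linear_adjoint_mat d\<gamma>] d2])
    define Q where "Q = adjoint_mat (\<gamma> t) ** a + adjoint_mat (\<gamma>' t) ** \<gamma>' t"
    have "adjoint_mat (adjoint_mat (\<gamma> t) ** a) = adjoint_mat (\<gamma> t) ** a"
      unfolding a_def \<gamma>_def by (rule isometry_acceleration_hermitian[OF iso GW c(1) X])
    then have herm: "adjoint_mat Q = Q" by (simp add: Q_def adjoint_mat_simps adjoint_mat_mult)
    have "((\<lambda>t. adjoint_mat (S t)) has_vector_derivative adjoint_mat Q) (at t)"
      using bounded_linear.has_vector_derivative[OF bounded_linear_adjoint_mat dS] by (simp add: Q_def)
    moreover have "(\<lambda>t. adjoint_mat (S t)) = (\<lambda>t. - S t)" using skewS by (auto simp: skew_def)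
    moreover have "((\<lambda>t. - S t) has_vector_derivative - Q) (at t)"
      using has_vector_derivative_minus[OF dS] by (simp add: Q_def)
    ultimately have "adjoint_mat Q = - Q" using vector_derivative_unique_at by metis
    with herm have "Q + Q = 0" by (simp add: eq_neg_iff_add_eq_0)
    then have "2 *\<^sub>R Q = 0" by (simp only: scaleR_2)
    then have "Q = 0" by simp
    with dS show ?thesis by (simp add: Q_def)
  qed
  then obtain C where C: "\<And>t. S t = C"
    using has_vector_derivative_zero_constant[of UNIV S] by auto
  have "\<gamma>' t = \<gamma> t ** S 0" 
    using C[of t] C[of 0] fU[of t] by (simp add: S_def \<gamma>_def unitary_groupD)
      (metis S_def \<gamma>_def unitary_groupD(3))
  moreover have "\<gamma>' 0 = frechet_derivative F (at (c 0)) (c 0 ** X)"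
    by (rule \<gamma>'_eq[OF F(1) _ F(3)]) (rule F(2))
  then have "S 0 = adjoint_mat (f (c 0)) ** frechet_derivative F (at (c 0)) (c 0 ** X)"
    by (simp add: S_def \<gamma>_def)
  ultimately show ?thesis using d\<gamma>[of t] by (simp add: \<gamma>_def[abs_def])
qed

text \<open>Since \<open>S\<close> is skew, the product of \<open>\<gamma> t\<close> with the
  adjoint of \<open>\<delta> t\<close> has derivative zero, and it starts at the identity.\<close>

lemma unitary_ode_unique:
  fixes \<gamma> \<delta> :: "real \<Rightarrow> complex^'n^'n"
  assumes "\<And>t. \<delta> t \<in> unitary_group" and S: "S \<in> skew"
    and g: "\<And>t. (\<gamma> has_vector_derivative \<gamma> t ** S) (at t)"
    and d: "\<And>t. (\<delta> has_vector_derivative \<delta> t ** S) (at t)"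
    and init: "\<gamma> 0 = \<delta> 0"
  shows "\<gamma> t = \<delta> t"
proof -
  have "((\<lambda>t. \<gamma> t ** adjoint_mat (\<delta> t)) has_vector_derivative 0) (at t)" for t
    using matmul.has_vector_derivative[OF g[of t] bounded_linear.has_vector_derivative[OF
          bounded_linear_adjoint_mat d[of t]]] S
    by (simp add: adjoint_mat_mult skew_def matmul.minus_left matmul.minus_right matrix_mul_assoc)
  then obtain C where C: "\<And>t. \<gamma> t ** adjoint_mat (\<delta> t) = C"
    using has_vector_derivative_zero_constant[of UNIV "\<lambda>t. \<gamma> t ** adjoint_mat (\<delta> t)"] by auto
  have "C = mat 1" using C[of 0] assms(1) by (simp add: init unitary_groupD)
  then have "\<gamma> t ** adjoint_mat (\<delta> t) ** \<delta> t = \<delta> t" using C by simp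
  then show ?thesis using assms(1) by (simp add: unitary_groupD)
qed

text \<open>Conjugating \<open>X\<close> by the curve gives a constant. This makes order-reversing
  maps such as transpose usable on one-parameter curves.\<close>

lemma one_parameter_commute:
  fixes c :: "real \<Rightarrow> complex^'n^'n"
  assumes cU: "\<And>t. c t \<in> unitary_group" and X: "X \<in> skew"
    and c: "\<And>t. (c has_vector_derivative c t ** X) (at t)" and "c 0 = mat 1"
  shows "c t ** X = X ** c t"
proof -
  have "((\<lambda>t. c t ** X ** adjoint_mat (c t)) has_vector_derivative 0) (at t)" for t
    using matmul.has_vector_derivative[OF bounded_linear.has_vector_derivative[OF
          matmul.bounded_linear_left c[of t], of X] bounded_linear.has_vector_derivative[OF
          bounded_linear_adjoint_mat c[of t]]] X
    by (simp add: adjoint_mat_mult skew_def matmul.minus_left matmul.minus_right matrix_mul_assoc)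
  then obtain C where C: "\<And>t. c t ** X ** adjoint_mat (c t) = C"
    using has_vector_derivative_zero_constant[of UNIV "\<lambda>t. c t ** X ** adjoint_mat (c t)"] by auto
  have "C = X" using C[of 0] by (simp add: assms)
  then have "c t ** X ** adjoint_mat (c t) ** c t = X ** c t" using C by simp
  then show ?thesis using cU by (simp add: unitary_groupD)
qed

section \<open>Wigner's theorem for skew-Hermitian matrices\<close>

definition skew_unit :: "'n \<Rightarrow> 'n \<Rightarrow> complex \<Rightarrow> complex^'n^'n" where
  "skew_unit i j a = (\<chi> k l. if k = i \<and> l = j then a else if k = j \<and> l = i then - cnj a else 0)"

lemma skew_unit_skew: "i \<noteq> j \<Longrightarrow> skew_unit i j a \<in> skew"
  by (auto simp: skew_def skew_unit_def vec_eq_iff)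

lemma skew_nth: "X \<in> skew \<Longrightarrow> X $ j $ i = - cnj (X $ i $ j)"
  using adjoint_mat_nth[of X j i] by (simp add: skew_def) (metis minus_minus)

lemma matvec_axis: "(A *v axis k 1) $ i = A $ i $ k" for A :: "complex^'n^'n"
  by (simp add: matrix_vector_mult_def axis_def if_distrib[of "\<lambda>x. _ * x"] sum.delta cong: if_cong)

lemma inner_skew_unit:
  fixes X :: "complex^'n^'n"
  assumes "i \<noteq> j" "X \<in> skew"
  shows "inner X (skew_unit i j a) = 2 * Re (X $ i $ j * cnj a)"
proof -
  have "inner X (skew_unit i j a) = (\<Sum>k\<in>UNIV. \<Sum>l\<in>UNIV.
      (if k = i then if l = j then Re (X $ i $ j * cnj a) else 0 else 0)
    + (if k = j then if l = i then Re (X $ j $ i * cnj (- cnj a)) else 0 else 0))"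
    unfolding inner_matrix using assms(1)
    by (intro sum.cong refl) (auto simp: skew_unit_def)
  also have "\<dots> = Re (X $ i $ j * cnj a) + Re (X $ j $ i * cnj (- cnj a))"
  proof -
    have "(\<Sum>l\<in>UNIV. if k = p then if l = q then c else 0 else 0) = (if k = p then c else 0)"
      for k p q :: 'n and c :: real by simp
    then show ?thesis by (simp only: sum.distrib) simp
  qed
  also have "\<dots> = 2 * Re (X $ i $ j * cnj a)"
    using skew_nth[OF assms(2), of j i] by simp
  finally show ?thesis .
qed

text \<open>Only the moduli of the coordinates of \<open>w\<close> are prescribed: they cancel the
  diagonal, so the unknown phases survive in a single off-diagonal pair.\<close>

lemma skew_unit_eq:
  assumes "i \<noteq> j" and w: "\<And>k. cmod (w $ k) = cmod ((axis i 1 + axis j z) $ k)"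
  shows "skew_dyad w - skew_dyad (axis i 1) - skew_dyad (axis j z) = skew_unit i j (\<i> * w $ i * cnj (w $ j))"
proof -
  have "w $ k = 0" if "k \<noteq> i" "k \<noteq> j" for k
    using w[of k] that by (simp add: axis_def)
  moreover have "w $ i * cnj (w $ i) = 1" "w $ j * cnj (w $ j) = z * cnj z"
    using w[of i] w[of j] assms(1) by (simp_all add: axis_def complex_norm_square[symmetric])
  ultimately show ?thesis
    using assms(1) by (auto simp: vec_eq_iff skew_unit_def axis_def algebra_simps)
qed

lemma hdot_axis_right: "hdot v (axis k 1) = cnj (v $ k)"
  by (metis cnj_hdot hdot_axis)

lemma inner_skew_dyad_axis: "inner (skew_dyad w) (skew_dyad (axis k 1)) = (cmod (w $ k))\<^sup>2"
  by (simp add: inner_skew_dyad_skew_dyad hdot_axis_right)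

text \<open>The linear form of Wigner's theorem: each off-diagonal entry is preserved or conjugated, and
  the rank one relation between the entries \<open>(i, j)\<close>, \<open>(j, k)\<close>, \<open>(i, k)\<close> makes the choice uniform.\<close>

lemma wigner_normalized:
  fixes T :: "complex^'n^'n \<Rightarrow> complex^'n^'n"
  assumes lin: "linear T" and sk: "\<And>X. X \<in> skew \<Longrightarrow> T X \<in> skew"
    and iso: "\<And>X Y. X \<in> skew \<Longrightarrow> Y \<in> skew \<Longrightarrow> inner (T X) (T Y) = inner X Y"
    and dyad: "\<And>v. \<exists>w. T (skew_dyad v) = skew_dyad w"
    and diag: "\<And>k. T (skew_dyad (axis k 1)) = skew_dyad (axis k 1)"
    and ones: "T (skew_dyad (\<chi> k. 1)) = skew_dyad (\<chi> k. 1)"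
  shows "(\<forall>X\<in>skew. T X = X) \<or> (\<forall>X\<in>skew. T X = transpose X)"
proof -
  have entry_diag: "T X $ i $ i = X $ i $ i" if X: "X \<in> skew" for X i
  proof -
    have *: "inner Y (skew_dyad (axis i 1)) = Im (Y $ i $ i)" for Y :: "complex^'n^'n"
      unfolding inner_skew_dyad hdot_axis by (simp add: matvec_axis)
    have "Im (T X $ i $ i) = Im (X $ i $ i)"
      using iso[OF X skew_dyad_skew, of "axis i 1"] by (simp add: diag *)
    moreover have "Re (Y $ i $ i) = 0" if "Y \<in> skew" for Y :: "complex^'n^'n"
      using skew_nth[OF that, of i i] by (auto simp: complex_eq_iff)
    ultimately show ?thesis using X sk by (simp add: complex_eq_iff)
  qed
  have unit: "\<exists>b. cmod b = cmod a \<and> T (skew_unit i j a) = skew_unit i j b" if ij: "i \<noteq> j" for i j a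
  proof -
    \<comment> \<open>With this \<open>z\<close> the (i, j) entry of \<open>skew_dyad v\<close> is
      \<open>a\<close>.\<close>
    define z where "z = cnj (- \<i> * a)"
    define v where "v = axis i 1 + axis j z"
    obtain w where w: "T (skew_dyad v) = skew_dyad w" using dyad by blast
    have wk: "cmod (w $ k) = cmod (v $ k)" for k
    proof -
      have "(cmod (w $ k))\<^sup>2 = (cmod (v $ k))\<^sup>2"
        using iso[OF skew_dyad_skew skew_dyad_skew, of v "axis k 1"]
        by (simp add: w diag inner_skew_dyad_axis)
      then show ?thesis by (simp add: power2_eq_iff_nonneg)
    qed
    have axisz: "axis j z = z *s axis j 1" by (simp add: vec_eq_iff axis_def)
    have "skew_unit i j a = skew_dyad v - skew_dyad (axis i 1) - skew_dyad (axis j z)"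
      using skew_unit_eq[OF ij, of v z] ij by (simp add: v_def axis_def z_def)
    then have "T (skew_unit i j a) = skew_dyad w - skew_dyad (axis i 1) - skew_dyad (axis j z)"
      by (simp add: linear_diff[OF lin] w diag axisz skew_dyad_smult linear_scale[OF lin])
    also have "\<dots> = skew_unit i j (\<i> * w $ i * cnj (w $ j))"
      by (rule skew_unit_eq[OF ij]) (simp add: wk v_def)
    finally show ?thesis
      using ij by (intro exI conjI) (auto simp: norm_mult wk v_def axis_def z_def)
  qed
  \<comment> \<open>Every entry of the dyad of the all-ones vector is i, so pairing with it yields
    \<open>Im b = 1\<close>, which with modulus 1 fixes \<open>b\<close>.\<close>
  have unit_i: "T (skew_unit i j \<i>) = skew_unit i j \<i>" if ij: "i \<noteq> j" for i j
  proof -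
    obtain b where b: "cmod b = 1" "T (skew_unit i j \<i>) = skew_unit i j b"
      using unit[OF ij, of \<i>] by auto
    have "Im b = 1"
      using iso[OF skew_dyad_skew skew_unit_skew[OF ij], of "\<chi> k. 1" \<i>]
      unfolding ones b inner_skew_unit[OF ij skew_dyad_skew] by simp
    with b(1) have "b = \<i>" by (simp add: complex_eq_iff cmod_def)
    with b show ?thesis by simp
  qed
  have Im_entry: "Im (T X $ i $ j) = Im (X $ i $ j)" if ij: "i \<noteq> j" and X: "X \<in> skew" for X i j
    using iso[OF X skew_unit_skew[OF ij], of \<i>]
    by (simp add: unit_i[OF ij] inner_skew_unit[OF ij] X sk)
  define P where "P i j \<longleftrightarrow> (\<forall>X\<in>skew. T X $ i $ j = X $ i $ j)" for i j
  have dich: "P i j \<or> (\<forall>X\<in>skew. T X $ i $ j = X $ j $ i)" if ij: "i \<noteq> j" for i j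
  proof -
    obtain b where b: "cmod b = 1" "T (skew_unit i j 1) = skew_unit i j b"
      using unit[OF ij, of 1] by auto
    have "Im (skew_unit i j b $ i $ j) = Im (skew_unit i j 1 $ i $ j)"
      using Im_entry[OF ij skew_unit_skew[OF ij], of 1] by (simp only: b)
    then have "Im b = 0" by (simp add: skew_unit_def)
    with b(1) have "b = 1 \<or> b = - 1" by (auto simp: complex_eq_iff cmod_def abs_if split: if_splits)
    moreover have "Re (T X $ i $ j * cnj b) = Re (X $ i $ j)" if X: "X \<in> skew" for X
      using iso[OF X skew_unit_skew[OF ij], of 1]
      by (simp only: b inner_skew_unit[OF ij] X sk) simp
    ultimately show ?thesis
    proof (elim disjE)
      assume "b = 1"
      then show ?thesis
        using \<open>\<And>X. X \<in> skew \<Longrightarrow> Re (T X $ i $ j * cnj b) = Re (X $ i $ j)\<close> Im_entry[OF ij]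
        by (simp add: P_def complex_eq_iff)
    next
      assume "b = - 1"
      then have "Re (T X $ i $ j) = - Re (X $ i $ j)" if "X \<in> skew" for X
        using \<open>\<And>X. X \<in> skew \<Longrightarrow> Re (T X $ i $ j * cnj b) = Re (X $ i $ j)\<close>[OF that] by simp
      then show ?thesis
        using Im_entry[OF ij] skew_nth[of _ j i] by (auto simp: complex_eq_iff)
    qed
  qed
  have P_sym: "P j i" if "P i j" for i j
    using that sk skew_nth[of _ i j] skew_nth[of _ j i] by (metis P_def)
  have P_step: "P j k" if ij: "i \<noteq> j" and jk: "j \<noteq> k" and ik: "i \<noteq> k" and P: "P i j" for i j k
  proof -
    \<comment> \<open>The single coordinate i makes the entries at (j, k) and (k, j) equal to -1 and
      1, telling the two cases apart, while the entry at (i, k) is i in either case.\<close>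
    define v :: "complex^'n" where "v = (\<chi> l. if l = j then \<i> else 1)"
    let ?X = "skew_dyad v"
    note X = skew_dyad_skew[of v]
    obtain w where w: "T ?X = skew_dyad w" using dyad by blast
    have "T ?X $ i $ j * T ?X $ j $ k = T ?X $ i $ k * T ?X $ j $ j"
      by (simp add: w)
    moreover have "T ?X $ i $ j = 1" using P X ij by (simp add: P_def v_def)
    moreover have "T ?X $ j $ j = \<i>" using entry_diag[OF X] by (simp add: v_def)
    moreover have "T ?X $ i $ k = \<i>"
      using dich[OF ik] X ij jk ik by (auto simp: P_def v_def)
    ultimately have "T ?X $ j $ k = - 1" by simp
    moreover have "?X $ k $ j = 1" using jk by (simp add: v_def)
    ultimately show ?thesis using dich[OF jk] X by fastforce
  qed
  show ?thesis
  proof (cases "\<forall>i j. i \<noteq> j \<longrightarrow> P i j")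
    case True
    then have "T X = X" if "X \<in> skew" for X
      using that entry_diag[OF that] unfolding vec_eq_iff P_def by metis
    then show ?thesis by blast
  next
    case False
    then obtain i j where ij: "i \<noteq> j" "\<not> P i j" by blast
    \<comment> \<open>A single pair with property \<open>P\<close> would spread through the shared
      index \<open>l\<close> to every pair, including the exceptional one.\<close>
    have nP: "\<not> P k l" if kl: "k \<noteq> l" for k l
    proof
      assume P: "P k l"
      have "P i l" if "i \<noteq> l"
      proof (cases "k = i")
        case False
        then show ?thesis using P_step[of k l i] P kl that P_sym by blast
      qed (use P in simp)
      moreover have "j \<noteq> l \<Longrightarrow> P j l"
      proof (cases "k = j")
        case False
        then show "j \<noteq> l \<Longrightarrow> P j l" using P_step[of k l j] P kl P_sym by blast
      qed (use P in simp)
      ultimately show False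
        using P_step[of j l i] P_step[of l i j] ij P_sym by metis
    qed
    have "T X $ k $ l = X $ l $ k" if "X \<in> skew" for X k l
      using dich[of k l] nP[of k l] entry_diag[OF that, of k] that by (cases "k = l") auto
    then have "\<forall>X\<in>skew. T X = transpose X" by (simp add: vec_eq_iff transpose_def)
    then show ?thesis by blast
  qed
qed

lemma unit_hdot_self: "norm x = 1 \<Longrightarrow> hdot x x = 1"
  by (simp add: hdot_self)

text \<open>The images of the coordinate dyads give an orthonormal basis, each vector known only up
  to phase. The image of the all-ones dyad fixes the phases, and conjugating by the resulting
  unitary reduces to the normalized case.\<close>

lemma wigner_skew:
  fixes T :: "complex^'n^'n \<Rightarrow> complex^'n^'n"
  assumes lin: "linear T" and sk: "\<And>X. X \<in> skew \<Longrightarrow> T X \<in> skew"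
    and iso: "\<And>X Y. X \<in> skew \<Longrightarrow> Y \<in> skew \<Longrightarrow> inner (T X) (T Y) = inner X Y"
    and dyad: "\<And>v. \<exists>w. T (skew_dyad v) = skew_dyad w"
  shows "\<exists>U\<in>unitary_group. (\<forall>X\<in>skew. T X = U ** X ** adjoint_mat U) \<or>
    (\<forall>X\<in>skew. T X = U ** transpose X ** adjoint_mat U)"
proof -
  have "\<forall>k. \<exists>w. T (skew_dyad (axis k 1)) = skew_dyad w" using dyad by blast
  then obtain u where u: "\<And>k. T (skew_dyad (axis k 1)) = skew_dyad (u k)"
    by metis
  obtain w where w: "T (skew_dyad (\<chi> k. 1)) = skew_dyad w" using dyad by blast
  have pres: "cmod (hdot a b) = cmod (hdot x y)"
    if "T (skew_dyad x) = skew_dyad a" "T (skew_dyad y) = skew_dyad b" for x y a b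
  proof -
    have "(cmod (hdot a b))\<^sup>2 = (cmod (hdot x y))\<^sup>2"
      using iso[OF skew_dyad_skew skew_dyad_skew, of x y]
      by (simp add: that inner_skew_dyad_skew_dyad)
    then show ?thesis by (simp add: power2_eq_iff_nonneg)
  qed
  \<comment> \<open>These phases are unimodular because the all-ones vector has inner product 1 with
    each coordinate vector; rescaling \<open>u k\<close> by \<open>h k\<close> makes every
    coordinate of \<open>w\<close> equal to 1.\<close>
  define h where "h k = hdot (u k) w" for k
  have h1: "cmod (h k) = 1" for k
    using pres[OF u w, of k] by (simp add: h_def hdot_axis)
  then have hh: "cnj (h k) * h k = 1" for k
    using complex_norm_square[of "h k"] by (simp add: mult.commute)
  define U :: "complex^'n^'n" where "U = (\<chi> i k. h k * u k $ i)"
  have Ue: "U *v axis k 1 = h k *s u k" for k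
    by (simp add: matvec_axis U_def vec_eq_iff)
  have orth: "hdot (u k) (u l) = (if k = l then 1 else 0)" for k l
  proof (cases "k = l")
    case True
    have "cmod (hdot (u k) (u k)) = 1" using pres[OF u u, of k k] by (simp add: hdot_axis)
    then show ?thesis using True by (simp add: hdot_self del: of_real_power)
  next
    case False
    have "cmod (hdot (u k) (u l)) = 0" using pres[OF u u, of k l] False unfolding hdot_axis by (simp add: axis_def)
    then show ?thesis using False by simp
  qed
  have "(adjoint_mat U ** U) $ k $ l = mat 1 $ k $ l" for k l
  proof -
    have "(adjoint_mat U ** U) $ k $ l = cnj (h k) * h l * hdot (u k) (u l)"
      by (simp add: matrix_matrix_mult_def U_def hdot_def sum_distrib_left algebra_simps)
    then show ?thesis using hh by (auto simp: orth mat_def)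
  qed
  then have UU: "adjoint_mat U ** U = mat 1" by (simp add: vec_eq_iff)
  then have U: "U \<in> unitary_group"
    using matrix_left_right_inverse[of U "adjoint_mat U"] by (simp add: unitary_group_def)
  define T' where "T' X = adjoint_mat U ** T X ** U" for X
  have T'dyad: "T' (skew_dyad x) = skew_dyad (adjoint_mat U *v a)" if "T (skew_dyad x) = skew_dyad a" for x a
    using skew_dyad_conj[of "adjoint_mat U" a] by (simp add: T'_def that)
  have T_eq: "T X = U ** T' X ** adjoint_mat U" for X
    using U by (simp add: T'_def matrix_mul_assoc unitary_groupD)
  have "(\<forall>X\<in>skew. T' X = X) \<or> (\<forall>X\<in>skew. T' X = transpose X)"
  proof (rule wigner_normalized)
    show "linear T'"
      by (rule linearI) (simp_all add: T'_def linear_add[OF lin] linear_scale[OF lin] matmul.add_left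
          matmul.add_right matmul.scaleR_left matmul.scaleR_right)
    show "T' X \<in> skew" if "X \<in> skew" for X
      using skew_conj[OF sk[OF that], of "adjoint_mat U"] by (simp add: T'_def)
    show "inner (T' X) (T' Y) = inner X Y" if "X \<in> skew" "Y \<in> skew" for X Y
      using U that by (simp add: T'_def inner_unitary_right inner_unitary_left unitary_group_adjoint iso)
    show "\<exists>w. T' (skew_dyad v) = skew_dyad w" for v
      using dyad[of v] T'dyad by blast
    show "T' (skew_dyad (axis k 1)) = skew_dyad (axis k 1)" for k
    proof -
      have "skew_dyad (u k) = skew_dyad (U *v axis k 1)"
        by (simp add: Ue skew_dyad_smult h1)
      then have "T' (skew_dyad (axis k 1)) = skew_dyad (adjoint_mat U *v (U *v axis k 1))"
        using T'dyad u by metis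
      then show ?thesis by (simp add: matrix_vector_mul_assoc UU)
    qed
    have "(adjoint_mat U *v w) $ k = 1" for k
      using hdot_matvec[of U "axis k 1" w] hh[of k] by (simp add: Ue hdot_smult hdot_axis h_def)
    then have "adjoint_mat U *v w = (\<chi> k. 1)" by (simp add: vec_eq_iff)
    then show "T' (skew_dyad (\<chi> k. 1)) = skew_dyad (\<chi> k. 1)" using T'dyad[OF w] by simp
  qed
  then show ?thesis using U T_eq by (intro bexI[of _ U]) auto
qed

text \<open>On an eigenvector \<open>v\<close> with eigenvalue i \<open>\<kappa>\<close>, the curve
  acts as rotation at speed \<open>\<kappa>\<close>, so the period makes \<open>\<kappa>\<close> an
  integer. Its absolute value is at most the norm of \<open>S\<close>, so \<open>\<kappa>\<close> is
  1 or -1, and equality in Cauchy-Schwarz identifies \<open>S\<close>.\<close>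

lemma skew_periodic_dyad:
  fixes S :: "complex^'n^'n"
  assumes S: "S \<in> skew" "norm S = 1"
    and g: "\<And>t. (\<gamma> has_vector_derivative \<gamma> t ** S) (at t)"
    and per: "\<gamma> (2 * pi) = \<gamma> 0" and inv: "\<gamma> 0 \<in> unitary_group"
  obtains x where "norm x = 1" "S = skew_dyad x \<or> S = - skew_dyad x"
proof -
  have adj: "inner (S *v x) y = - inner x (S *v y)" for x y
  proof -
    have "hdot (S *v x) y = - hdot x (S *v y)"
      using S(1) by (simp add: hdot_matvec skew_def matvec.minus_left hdot_minus)
    then show ?thesis by (simp flip: Re_hdot)
  qed
  have lin: "linear (\<lambda>y. S *v (S *v y))"
    by (rule linearI) (simp_all add: matvec.add_right matvec.scaleR_right)
  have sym: "inner (S *v (S *v x)) y = inner x (S *v (S *v y))" for x y by (simp add: adj)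
  obtain x m where x: "norm x = 1" "S *v (S *v x) = m *\<^sub>R x"
    and min: "\<And>y. m * (norm y)\<^sup>2 \<le> inner y (S *v (S *v y))"
    using selfadjoint_min_eigenvector[OF lin sym] by blast
  have "m < 0"
  proof (rule ccontr)
    assume "\<not> m < 0"
    then have "0 \<le> m * (norm y)\<^sup>2" for y :: "complex^'n" by simp
    then have "inner (S *v y) (S *v y) \<le> 0" for y
      using min[of y] adj[of y "S *v y"] by (metis neg_le_0_iff_le order_trans)
    then have "S *v y = 0" for y by (metis inner_ge_zero inner_eq_zero_iff order_antisym)
    then have "S = 0" by (intro matrix_eqI) simp
    then show False using S(2) by simp
  qed
  define r where "r = sqrt (- m)"
  have r: "r > 0" "m = - r\<^sup>2" using \<open>m < 0\<close> by (simp_all add: r_def)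
  \<comment> \<open>From the factorization of \<open>S\<close> squared plus \<open>r\<close>
    squared: either \<open>y\<close> is an eigenvector for i r, or it vanishes and \<open>x\<close>
    is one for -i r.\<close>
  define y where "y = S *v x + (\<i> * r) *s x"
  have Sy: "S *v y = (\<i> * r) *s y"
    unfolding y_def matvec.add_right vector_scalar_commute x(2) r(2) 
    by (simp add: vec_eq_iff scaleR_conv_of_real[where 'a=complex] power2_eq_square algebra_simps)
  obtain v \<kappa> where v: "norm v = 1" "S *v v = (\<i> * complex_of_real \<kappa>) *s v" "\<kappa> \<noteq> 0"
  proof (cases "y = 0")
    case True
    then have "S *v x = (\<i> * complex_of_real (- r)) *s x"
      by (simp add: y_def vec_eq_iff eq_neg_iff_add_eq_0)
    then show ?thesis using that[of x "- r"] x(1) r(1) by simp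
  next
    case False
    then show ?thesis using normalize_eigenvector[OF False Sy] that r(1) by (metis less_irrefl)
  qed
  have vv: "hdot v v = 1" by (rule unit_hdot_self[OF v(1)])
  have in_ev: "inner S (skew_dyad v) = \<kappa>"
    by (simp add: inner_skew_dyad v(2) hdot_smult vv)
  have "\<bar>\<kappa>\<bar> \<le> norm S * norm (skew_dyad v)"
    using Cauchy_Schwarz_ineq2[of S "skew_dyad v"] by (simp add: in_ev)
  then have abs_ev: "\<bar>\<kappa>\<bar> \<le> 1" by (simp add: S norm_skew_dyad v(1))
  have "((\<lambda>t. cis (- \<kappa> * t) * hdot p (\<gamma> t *v v)) has_vector_derivative 0) (at t)" for t p
  proof -
    have bl: "bounded_linear (hdot p)"
      unfolding linear_conv_bounded_linear[symmetric]
      by (rule linearI) (simp_all add: hdot_add hdot_smult scaleR_conv_of_real[where 'a=complex] flip: smult_eq_scaleR)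
    have 1: "((\<lambda>t. hdot p (\<gamma> t *v v)) has_vector_derivative \<i> * \<kappa> * hdot p (\<gamma> t *v v)) (at t)"
      using bounded_linear.has_vector_derivative[OF bl bounded_linear.has_vector_derivative[OF
          matvec.bounded_linear_left g[of t]], of v]
      by (simp add: v(2) vector_scalar_commute hdot_smult flip: matrix_vector_mul_assoc)
    have 2: "((\<lambda>t. cis (- \<kappa> * t)) has_vector_derivative - \<kappa> *\<^sub>R (\<i> * cis (- \<kappa> * t))) (at t)"
      unfolding has_vector_derivative_complex_iff cis.sel
      by (auto intro!: derivative_eq_intros)
    show ?thesis
      using has_vector_derivative_mult[OF 2 1] by (simp add: scaleR_conv_of_real algebra_simps)
  qed
  then have const: "cis (- \<kappa> * (2 * pi)) * hdot p (\<gamma> (2 * pi) *v v) = cis (- \<kappa> * 0) * hdot p (\<gamma> 0 *v v)" for p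
    using has_vector_derivative_zero_constant[of UNIV "\<lambda>t. cis (- \<kappa> * t) * hdot p (\<gamma> t *v v)"]
    by (metis UNIV_I convex_UNIV has_vector_derivative_at_within)
  have "hdot (\<gamma> 0 *v v) (\<gamma> 0 *v v) = 1" using inv vv by (simp add: hdot_unitary)
  then have "cis (- \<kappa> * (2 * pi)) = 1" using const[of "\<gamma> 0 *v v"] per by simp
  then have "cos (\<kappa> * (2 * pi)) = 1" by (simp add: complex_eq_iff)
  then obtain n :: int where "\<kappa> * (2 * pi) = n * 2 * pi" by (auto simp: cos_one_2pi_int)
  then have "\<kappa> = n" by simp
  with abs_ev v(3) have "n \<noteq> 0" "\<bar>n\<bar> \<le> 1" by auto
  then have "\<kappa> = 1 \<or> \<kappa> = - 1" using \<open>\<kappa> = n\<close> by (auto simp: abs_le_iff)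
  moreover have "inner (S - \<kappa> *\<^sub>R skew_dyad v) (S - \<kappa> *\<^sub>R skew_dyad v) = 1 - \<kappa>\<^sup>2"
  proof -
    have "inner S S = 1" using S(2) by (simp add: norm_eq_1)
    moreover have "inner (skew_dyad v) (skew_dyad v) = 1" by (simp add: inner_skew_dyad_skew_dyad vv)
    ultimately show ?thesis
      by (simp add: inner_diff_left inner_diff_right in_ev inner_commute[of "skew_dyad v" S] power2_eq_square)
  qed
  ultimately have "inner (S - \<kappa> *\<^sub>R skew_dyad v) (S - \<kappa> *\<^sub>R skew_dyad v) = 0"
    by (metis diff_self one_power2 power2_minus)
  then have "S = \<kappa> *\<^sub>R skew_dyad v" by (simp only: inner_eq_zero_iff right_minus_eq)
  with \<open>\<kappa> = 1 \<or> \<kappa> = - 1\<close> show ?thesis using that[OF v(1)] by auto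
qed

lemma dyad_sign_uniform:
  fixes T :: "complex^'n^'n \<Rightarrow> complex^'n^'n"
  assumes iso: "\<And>X Y. X \<in> skew \<Longrightarrow> Y \<in> skew \<Longrightarrow> inner (T X) (T Y) = inner X Y"
    and dyad: "\<And>v. \<exists>w. T (skew_dyad v) = skew_dyad w \<or> T (skew_dyad v) = - skew_dyad w"
  shows "(\<forall>v. \<exists>w. T (skew_dyad v) = skew_dyad w) \<or> (\<forall>v. \<exists>w. T (skew_dyad v) = - skew_dyad w)"
proof (rule ccontr)
  assume "\<not> ?thesis"
  then obtain u v where u: "\<And>w. T (skew_dyad u) \<noteq> skew_dyad w" and v: "\<And>w. T (skew_dyad v) \<noteq> - skew_dyad w"
    by blast
  have opp: "hdot a b = 0" if "T (skew_dyad a) = skew_dyad c" "T (skew_dyad b) = - skew_dyad d" for a b c d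
  proof -
    have "(cmod (hdot a b))\<^sup>2 = - (cmod (hdot c d))\<^sup>2"
      using iso[OF skew_dyad_skew skew_dyad_skew, of a b] that by (simp add: inner_skew_dyad_skew_dyad)
    then have "(cmod (hdot a b))\<^sup>2 \<le> 0" by simp
    then show ?thesis by simp
  qed
  obtain u' v' where u': "T (skew_dyad u) = - skew_dyad u'" and v': "T (skew_dyad v) = skew_dyad v'"
    using dyad u v by metis
  \<comment> \<open>The zero dyad carries both signs, so \<open>u\<close> and \<open>v\<close> must
    be nonzero.\<close>
  have "skew_dyad 0 = (0 :: complex^'n^'n)" by (simp add: vec_eq_iff)
  moreover from this have "T 0 = 0"
    using iso[OF skew_dyad_skew skew_dyad_skew, of 0 0] by simp
  ultimately have "u \<noteq> 0" "v \<noteq> 0" using u[of 0] v[of 0] by auto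
  have vu: "hdot v u = 0" "hdot u v = 0" using opp[OF v' u'] cnj_hdot[of v u] by auto
  \<comment> \<open>Opposite signs force \<open>u\<close> and \<open>v\<close> to be orthogonal;
    their sum is orthogonal to neither, so no sign is left for it.\<close>
  obtain q where "T (skew_dyad (u + v)) = skew_dyad q \<or> T (skew_dyad (u + v)) = - skew_dyad q"
    using dyad by blast
  then have "hdot (u + v) u = 0 \<or> hdot v (u + v) = 0" using opp u' v' by blast
  then show False using vu \<open>u \<noteq> 0\<close> \<open>v \<noteq> 0\<close> by (simp add: hdot_add hdot_self)
qed

section \<open>Classification\<close>

text \<open>All four families arise with \<open>T\<close> the identity, adjoint, conjugate or
  transpose. Each is a real-linear involution, which makes the inverse explicit.\<close>

lemma isometry_of_form:
  fixes f :: "complex^'n^'n \<Rightarrow> complex^'n^'n"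
  assumes A: "A \<in> unitary_group" and B: "B \<in> unitary_group"
    and T: "linear T" "\<And>X. X \<in> unitary_group \<Longrightarrow> T X \<in> unitary_group"
      "\<And>X. T (T X) = X" "\<And>X Y. inner (T X) (T Y) = inner X Y"
    and f: "\<And>X. X \<in> unitary_group \<Longrightarrow> f X = A ** T X ** B"
  shows "riemannian_isometry unitary_group frobenius_metric f"
proof (rule riemannian_isometry_linear)
  show "linear (\<lambda>X. A ** T X ** B)"
    by (rule linearI) (simp_all add: linear_add[OF T(1)] linear_scale[OF T(1)] matmul.add_left
        matmul.add_right matmul.scaleR_left matmul.scaleR_right)
  show "linear (\<lambda>X. T (adjoint_mat A ** X ** adjoint_mat B))"
    by (rule linearI) (simp_all add: linear_add[OF T(1)] linear_scale[OF T(1)] matmul.add_left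
        matmul.add_right matmul.scaleR_left matmul.scaleR_right)
  show "A ** T X ** B \<in> unitary_group" if "X \<in> unitary_group" for X
    using that by (intro unitary_group_mult T A B)
  show "T (adjoint_mat A ** X ** adjoint_mat B) \<in> unitary_group" if "X \<in> unitary_group" for X
    using that by (intro unitary_group_mult T A B unitary_group_adjoint)
  show "T (adjoint_mat A ** (A ** T X ** B) ** adjoint_mat B) = X" for X
    using A B by (simp add: matrix_mul_assoc unitary_groupD T)
  show "A ** T (T (adjoint_mat A ** X ** adjoint_mat B)) ** B = X" for X
    using A B by (simp add: matrix_mul_assoc unitary_groupD T)
  show "frobenius_metric (A ** T P ** B) (A ** T X ** B) (A ** T Y ** B) = frobenius_metric P X Y" for P X Y
    by (simp add: frobenius_metric_eq_inner inner_unitary_left inner_unitary_right A B T)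
qed (rule f)

text \<open>Hides the choice of local extension. \<open>T\<close> is linear on all matrices because
  it comes from an ambient derivative; its geometric properties concern \<open>skew\<close>.\<close>

lemma isometry_at_identity:
  fixes f :: "complex^'n^'n \<Rightarrow> complex^'n^'n"
  assumes iso: "riemannian_isometry unitary_group frobenius_metric f"
  obtains T where "linear T" "\<And>X. X \<in> skew \<Longrightarrow> T X \<in> skew"
    "\<And>X Y. X \<in> skew \<Longrightarrow> Y \<in> skew \<Longrightarrow> inner (T X) (T Y) = inner X Y"
    "\<And>c X t. \<lbrakk>\<And>t. c t \<in> unitary_group; \<And>t. (c has_vector_derivative c t ** X) (at t); X \<in> skew;
      c 0 = mat 1\<rbrakk> \<Longrightarrow> ((\<lambda>t. f (c t)) has_vector_derivative f (c t) ** T X) (at t)"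
proof -
  obtain V F where VF: "mat 1 \<in> V" "smooth_on_open F V" "\<And>x. x \<in> V \<inter> unitary_group \<Longrightarrow> F x = f x"
    using iso unitary_group_one unfolding riemannian_isometry_def diffeomorphism_of_def smooth_map_on_def
    by metis
  define T where "T X = adjoint_mat (f (mat 1)) ** frechet_derivative F (at (mat 1)) X" for X
  note fU = isometry_unitary[OF iso unitary_group_one]
  show ?thesis
  proof (rule that[of T])
    show "linear T"
      using linear_compose[OF smooth_linear_frechet_derivative[OF VF(2,1)] linear_matmul(1)]
      by (simp add: T_def[abs_def] o_def)
    show "T X \<in> skew" if "X \<in> skew" for X
      using isometry_differential_skew[OF iso VF(2,3,1) unitary_group_one that] by (simp add: T_def)
    show "inner (T X) (T Y) = inner X Y" if "X \<in> skew" "Y \<in> skew" for X Y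
      using isometry_inner[OF iso VF(2,3,1) unitary_group_one that]
      by (simp add: T_def inner_unitary_left unitary_group_adjoint fU)
    show "((\<lambda>t. f (c t)) has_vector_derivative f (c t) ** T X) (at t)"
      if "\<And>t. c t \<in> unitary_group" "\<And>t. (c has_vector_derivative c t ** X) (at t)" "X \<in> skew"
        "c 0 = mat 1" for c X t
      using isometry_geodesic[OF iso that(1,2,3) VF(2,3), of t] VF(1) by (simp add: T_def that(4))
  qed
qed

lemma isometry_dyad:
  fixes f :: "complex^'n^'n \<Rightarrow> complex^'n^'n"
  assumes iso: "riemannian_isometry unitary_group frobenius_metric f"
    and lin: "linear T" and sk: "\<And>X. X \<in> skew \<Longrightarrow> T X \<in> skew"
    and inner_T: "\<And>X Y. X \<in> skew \<Longrightarrow> Y \<in> skew \<Longrightarrow> inner (T X) (T Y) = inner X Y"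
    and geo: "\<And>c X t. \<lbrakk>\<And>t. c t \<in> unitary_group; \<And>t. (c has_vector_derivative c t ** X) (at t); X \<in> skew;
      c 0 = mat 1\<rbrakk> \<Longrightarrow> ((\<lambda>t. f (c t)) has_vector_derivative f (c t) ** T X) (at t)"
  shows "\<exists>w. T (skew_dyad v) = skew_dyad w \<or> T (skew_dyad v) = - skew_dyad w"
proof (cases "v = 0")
  case True
  then have "skew_dyad v = 0" by (simp add: vec_eq_iff)
  moreover have "skew_dyad 0 = (0 :: complex^'n^'n)" by (simp add: vec_eq_iff)
  ultimately show ?thesis using linear_0[OF lin] by metis
next
  case False
  define u where "u = complex_of_real (1 / norm v) *s v"
  have u: "norm u = 1"
    using False unfolding u_def norm_smult_complex by (simp add: norm_divide)
  have v: "v = complex_of_real (norm v) *s u" using False by (simp add: vec_eq_iff u_def)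
  define c where "c = rodrigues (skew_dyad u)"
  note K = skew_dyad_skew[of u] unit_skew_dyad_cube[OF u]
  have cU: "c t \<in> unitary_group" for t by (simp add: c_def rodrigues_unitary K)
  have dc: "((\<lambda>t. f (c t)) has_vector_derivative f (c t) ** T (skew_dyad u)) (at t)" for t
    by (rule geo[OF cU _ K(1)]) (simp_all add: c_def rodrigues_deriv K)
  have "(norm (T (skew_dyad u)))\<^sup>2 = (norm (skew_dyad u))\<^sup>2"
    by (simp add: power2_norm_eq_inner inner_T skew_dyad_skew)
  then have nT: "norm (T (skew_dyad u)) = 1"
    by (simp add: norm_skew_dyad u power2_eq_1_iff) (smt (verit) norm_ge_zero)
  obtain x where "T (skew_dyad u) = skew_dyad x \<or> T (skew_dyad u) = - skew_dyad x"
    by (rule skew_periodic_dyad[OF sk[OF K(1)] nT dc])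
       (simp_all add: isometry_unitary[OF iso] cU, simp add: c_def rodrigues_def)
  moreover have "T (skew_dyad v) = (norm v)\<^sup>2 *\<^sub>R T (skew_dyad u)"
    by (subst v) (simp add: skew_dyad_smult linear_scale[OF lin] del: of_real_power)
  moreover have "(norm v)\<^sup>2 *\<^sub>R skew_dyad x = skew_dyad (complex_of_real (norm v) *s x)"
    by (simp add: skew_dyad_smult)
  ultimately show ?thesis by (metis scaleR_minus_right)
qed

text \<open>The map \<open>\<tau>\<close> acts on the group and on its Lie algebra at once, so
  \<open>f\<close> and the candidate with \<open>A = f (mat 1) ** U\<close> and
  \<open>B = adjoint_mat U\<close> solve the same linear equation along each one-parameter
  curve.\<close>

lemma isometry_determined_by_differential:
  fixes f :: "complex^'n^'n \<Rightarrow> complex^'n^'n"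
  assumes iso: "riemannian_isometry unitary_group frobenius_metric f"
    and geo: "\<And>c X t. \<lbrakk>\<And>t. c t \<in> unitary_group; \<And>t. (c has_vector_derivative c t ** X) (at t); X \<in> skew;
      c 0 = mat 1\<rbrakk> \<Longrightarrow> ((\<lambda>t. f (c t)) has_vector_derivative f (c t) ** T X) (at t)"
    and U: "U \<in> unitary_group" and T: "\<And>X. X \<in> skew \<Longrightarrow> T X = U ** \<tau> X ** adjoint_mat U"
    and \<tau>: "linear \<tau>" "\<And>X. X \<in> unitary_group \<Longrightarrow> \<tau> X \<in> unitary_group" "\<tau> (mat 1) = mat 1"
      "\<And>X. X \<in> skew \<Longrightarrow> \<tau> X \<in> skew"
      "(\<forall>X Y. \<tau> (X ** Y) = \<tau> X ** \<tau> Y) \<or> (\<forall>X Y. \<tau> (X ** Y) = \<tau> Y ** \<tau> X)"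
  shows "\<exists>A\<in>unitary_group. \<exists>B\<in>unitary_group. \<forall>X\<in>unitary_group. f X = A ** \<tau> X ** B"
proof (intro bexI ballI)
  fix V :: "complex^'n^'n" assume "V \<in> unitary_group"
  then obtain X c where X: "X \<in> skew" and c: "\<And>t. c t \<in> unitary_group" "c 0 = mat 1" "c 1 = V"
    "\<And>t. (c has_vector_derivative c t ** X) (at t)"
    using unitary_one_parameter[of V] by blast
  define \<delta> where "\<delta> t = f (mat 1) ** U ** \<tau> (c t) ** adjoint_mat U" for t
  have comm: "\<tau> (c t ** X) = \<tau> (c t) ** \<tau> X" for t
    using \<tau>(5) one_parameter_commute[OF c(1) X c(4) c(2)] by metis
  have "f (c 1) = \<delta> 1"
  proof (rule unitary_ode_unique[where S = "T X"])
    show "\<delta> t \<in> unitary_group" for t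
      unfolding \<delta>_def
      by (intro unitary_group_mult isometry_unitary[OF iso] unitary_group_one \<tau> c U unitary_group_adjoint)
    show "T X \<in> skew" unfolding T[OF X] by (intro skew_conj \<tau> X)
    show "((\<lambda>t. f (c t)) has_vector_derivative f (c t) ** T X) (at t)" for t
      by (rule geo[OF c(1) c(4) X c(2)])
    have "bounded_linear (\<lambda>Y. f (mat 1) ** U ** \<tau> Y ** adjoint_mat U)"
      unfolding linear_conv_bounded_linear[symmetric]
      by (rule linearI) (simp_all add: linear_add[OF \<tau>(1)] linear_scale[OF \<tau>(1)] matmul.add_left
        matmul.add_right matmul.scaleR_left matmul.scaleR_right)
    from bounded_linear.has_vector_derivative[OF this c(4)]
    have "(\<delta> has_vector_derivative f (mat 1) ** U ** (\<tau> (c t) ** \<tau> X) ** adjoint_mat U) (at t)" for t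
      by (simp add: \<delta>_def[abs_def] comm)
    moreover have "f (mat 1) ** U ** (\<tau> (c t) ** \<tau> X) ** adjoint_mat U = \<delta> t ** T X" for t
      by (simp add: \<delta>_def T[OF X] matrix_mul_assoc unitary_groupD(6)[OF U])
    ultimately show "(\<delta> has_vector_derivative \<delta> t ** T X) (at t)" for t by simp
    show "f (c 0) = \<delta> 0" by (simp add: \<delta>_def c \<tau> unitary_groupD(5)[OF U])
  qed
  then show "f V = f (mat 1) ** U ** \<tau> V ** adjoint_mat U" by (simp add: c \<delta>_def)
qed (intro unitary_group_mult isometry_unitary[OF iso] unitary_group_one U unitary_group_adjoint)+

theorem theorem4p8:
  fixes f :: "complex^'n^'n \<Rightarrow> complex^'n^'n"
  assumes "CARD('n) \<ge> 3"
  shows "riemannian_isometry unitary_group frobenius_metric f \<longleftrightarrow>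
    (\<exists>A\<in>unitary_group. \<exists>B\<in>unitary_group.
       (\<forall>X\<in>unitary_group. f X = A ** X ** B) \<or>
       (\<forall>X\<in>unitary_group. f X = A ** adjoint_mat X ** B) \<or>
       (\<forall>X\<in>unitary_group. f X = A ** conj_mat X ** B) \<or>
       (\<forall>X\<in>unitary_group. f X = A ** transpose X ** B))"
    (is "?iso \<longleftrightarrow> ?forms")
proof
  have lin: "linear (transpose :: complex^'n^'n \<Rightarrow> complex^'n^'n)"
    unfolding transpose_eq_conj_adjoint[abs_def]
    using linear_compose[OF linear_adjoint_mat linear_conj_mat] by (simp add: o_def)
  have tU: "transpose X \<in> unitary_group" if "X \<in> unitary_group" for X :: "complex^'n^'n"
    using that by (simp add: transpose_eq_conj_adjoint unitary_group_conj unitary_group_adjoint)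
  have ti: "inner (transpose X) (transpose Y) = inner X Y" for X Y :: "complex^'n^'n"
    by (simp add: transpose_eq_conj_adjoint inner_conj_mat inner_adjoint_mat)
  {
    assume ?forms
    then obtain A B where AB: "A \<in> unitary_group" "B \<in> unitary_group"
      and "(\<forall>X\<in>unitary_group. f X = A ** X ** B) \<or>
       (\<forall>X\<in>unitary_group. f X = A ** adjoint_mat X ** B) \<or>
       (\<forall>X\<in>unitary_group. f X = A ** conj_mat X ** B) \<or>
       (\<forall>X\<in>unitary_group. f X = A ** transpose X ** B)" by blast
    then show ?iso
      using isometry_of_form[OF AB linear_id, of f, unfolded id_def]
        isometry_of_form[OF AB linear_adjoint_mat unitary_group_adjoint adjoint_adjoint_mat inner_adjoint_mat, of f]
        isometry_of_form[OF AB linear_conj_mat unitary_group_conj conj_conj_mat inner_conj_mat, of f]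
        isometry_of_form[OF AB lin tU transpose_transpose ti, of f]
      by blast
  next
    assume iso: ?iso
    obtain T where T: "linear T" "\<And>X. X \<in> skew \<Longrightarrow> T X \<in> skew"
      "\<And>X Y. X \<in> skew \<Longrightarrow> Y \<in> skew \<Longrightarrow> inner (T X) (T Y) = inner X Y"
      and geo: "\<And>c X t. \<lbrakk>\<And>t. c t \<in> unitary_group; \<And>t. (c has_vector_derivative c t ** X) (at t); X \<in> skew;
        c 0 = mat 1\<rbrakk> \<Longrightarrow> ((\<lambda>t. f (c t)) has_vector_derivative f (c t) ** T X) (at t)"
      using isometry_at_identity[OF iso] by blast
    have skt: "transpose X \<in> skew" if "X \<in> skew" for X :: "complex^'n^'n"
      using that by (simp add: skew_def vec_eq_iff transpose_def)
    have am: "- X = adjoint_mat X" and ct: "- transpose X = conj_mat X"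
      if "X \<in> skew" for X :: "complex^'n^'n"
      using that by (simp_all add: skew_def transpose_eq_conj_adjoint linear_neg[OF linear_conj_mat])
    have ska: "adjoint_mat X \<in> skew" and skc: "conj_mat X \<in> skew"
      if "X \<in> skew" for X :: "complex^'n^'n"
      using that skt[OF that] by (simp_all flip: am ct add: subspace_neg[OF subspace_skew])
    have "(\<forall>v. \<exists>w. T (skew_dyad v) = skew_dyad w) \<or> (\<forall>v. \<exists>w. T (skew_dyad v) = - skew_dyad w)"
      by (rule dyad_sign_uniform[OF T(3) isometry_dyad[OF iso T geo]])
    then show ?forms
    proof
      assume "\<forall>v. \<exists>w. T (skew_dyad v) = skew_dyad w"
      then obtain U where U: "U \<in> unitary_group"
        "(\<forall>X\<in>skew. T X = U ** X ** adjoint_mat U) \<or> (\<forall>X\<in>skew. T X = U ** transpose X ** adjoint_mat U)"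
        using wigner_skew[OF T] by blast
      from U(2) show ?forms
      proof
        assume "\<forall>X\<in>skew. T X = U ** X ** adjoint_mat U"
        then have "\<exists>A\<in>unitary_group. \<exists>B\<in>unitary_group. \<forall>X\<in>unitary_group. f X = A ** X ** B"
          by (intro isometry_determined_by_differential[where T = T and \<tau> = "\<lambda>X. X", OF iso geo U(1)])
             (simp_all add: linear_ident)
        then show ?forms by blast
      next
        assume "\<forall>X\<in>skew. T X = U ** transpose X ** adjoint_mat U"
        then have "\<exists>A\<in>unitary_group. \<exists>B\<in>unitary_group. \<forall>X\<in>unitary_group. f X = A ** transpose X ** B"
          by (intro isometry_determined_by_differential[where T = T and \<tau> = transpose, OF iso geo U(1)])
             (simp_all add: lin tU skt matrix_transpose_mul transpose_mat)
        then show ?forms by blast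
      qed
    next
      assume neg: "\<forall>v. \<exists>w. T (skew_dyad v) = - skew_dyad w"
      have "\<exists>U\<in>unitary_group. (\<forall>X\<in>skew. - T X = U ** X ** adjoint_mat U) \<or>
          (\<forall>X\<in>skew. - T X = U ** transpose X ** adjoint_mat U)"
      proof (rule wigner_skew)
        show "linear (\<lambda>X. - T X)" using T(1) by (rule linear_compose_neg)
        show "- T X \<in> skew" if "X \<in> skew" for X
          using T(2)[OF that] by (intro subspace_neg subspace_skew)
        show "\<exists>w. - T (skew_dyad v) = skew_dyad w" for v using neg by (metis minus_minus)
      qed (simp add: T(3))
      then obtain U where U: "U \<in> unitary_group"
        "(\<forall>X\<in>skew. - T X = U ** X ** adjoint_mat U) \<or> (\<forall>X\<in>skew. - T X = U ** transpose X ** adjoint_mat U)"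
        by blast
      have sgn: "T X = U ** (- Y) ** adjoint_mat U" if "- T X = U ** Y ** adjoint_mat U" for X Y
        using that by (simp add: matmul.minus_left matmul.minus_right flip: that)
      from U(2) show ?forms
      proof
        assume "\<forall>X\<in>skew. - T X = U ** X ** adjoint_mat U"
        then have "T X = U ** adjoint_mat X ** adjoint_mat U" if "X \<in> skew" for X
          using sgn am that by metis
        then have "\<exists>A\<in>unitary_group. \<exists>B\<in>unitary_group. \<forall>X\<in>unitary_group. f X = A ** adjoint_mat X ** B"
          by (intro isometry_determined_by_differential[where T = T and \<tau> = adjoint_mat, OF iso geo U(1)])
             (simp_all add: linear_adjoint_mat unitary_group_adjoint ska adjoint_mat_mult)
        then show ?forms by blast
      next
        assume "\<forall>X\<in>skew. - T X = U ** transpose X ** adjoint_mat U"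
        then have "T X = U ** conj_mat X ** adjoint_mat U" if "X \<in> skew" for X
          using sgn ct that by metis
        then have "\<exists>A\<in>unitary_group. \<exists>B\<in>unitary_group. \<forall>X\<in>unitary_group. f X = A ** conj_mat X ** B"
          by (intro isometry_determined_by_differential[where T = T and \<tau> = conj_mat, OF iso geo U(1)])
             (simp_all add: linear_conj_mat unitary_group_conj skc conj_mat_mult)
        then show ?forms by blast
      qed
    qed
  }
qed

end
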